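(* Consider the multistage stochastic program, the ISDDP algorithm, and the sequences of decisions $(x_n^k)_{n\in\mathcal{N}}$ and of functions $(\mathcal{Q}_t^k)$ generated in the simulation of ISDDP, all described in the context. Assume (H), (H1) and (H2) of the context hold, and that for all $t$ we have $\lim_{k\to+\infty}\varepsilon_t^k=\lim_{k\to+\infty}\delta_t^k=0$. Then almost surely the limit of the sequence $(\underline{\mathfrak{Q}}_1^{k-1}(x_0,\xi_1))_{k\ge1}$ is the optimal value $\mathcal{Q}_1(x_0)$ of the problem. Moreover, for $t=2,\dots,T$, almost surely the sequence of functions $(\mathcal{Q}_t^k)_k$ converges uniformly to a continuous function $\mathcal{Q}_t^*$ which coincides with $\mathcal{Q}_t$ at every accumulation point $\bar x_n$ of the sequence $(x_n^k)_k$, for every node $n$ of stage $t-1$.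
   Context: **Problem.** $T$ stages, $x_0\in\mathbb{R}^n$ given, $(\xi_t)_{t=1}^T$ a stochastic process with $\xi_1$ deterministic; $\xi_t$ contains in particular the random matrices and vector $A_t,B_t,b_t$. Feasible sets: $X_t(x_{t-1},\xi_t)=\{x_t\in\mathbb{R}^n: A_tx_t+B_tx_{t-1}=b_t,\ g_t(x_t,x_{t-1},\xi_t)\le0,\ x_t\in\mathcal{X}_t\}$, with $g_t=(g_{t1},\dots,g_{tp})$. Dynamic programming equations: $\mathcal{Q}_{T+1}\equiv0$; for $t=2,\dots,T$, $\mathcal{Q}_t(x_{t-1})=\mathbb{E}_{\xi_t}[\mathfrak{Q}_t(x_{t-1},\xi_t)]$ with $\mathfrak{Q}_t(x_{t-1},\xi_t)=\min\{f_t(x_t,x_{t-1},\xi_t)+\mathcal{Q}_{t+1}(x_t): x_t\in X_t(x_{t-1},\xi_t)\}$; the optimal value of the problem is $\mathcal{Q}_1(x_0)=\min\{f_1(x_1,x_0,\xi_1)+\mathcal{Q}_2(x_1): x_1\in X_1(x_0,\xi_1)\}$. **(H)** $(\xi_t)$ is interstage independent; for $t=2,\dots,T$, $\xi_t$ takes values in $\mathbb{R}^K$ with finite support $\Theta_t=\{\xi_{t1},\dots,\xi_{tN_t}\}$ and $p_{ti}=\mathbb{P}(\xi_t=\xi_{ti})>0$; $\xi_1$ is deterministic ($N_1=1$, $\xi_{11}=\xi_1$). $A_{tj},B_{tj},b_{tj}$ are the realizations of $A_t,B_t,b_t$ in $\xi_{tj}$. **(H1)** Set $\mathcal{X}_0=\{x_0\}$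 and $\mathcal{X}^\varepsilon=\mathcal{X}+\{x:\|x\|\le\varepsilon\}$. There is $\varepsilon>0$ such that for $t=1,\dots,T$: 1) $\mathcal{X}_t$ is nonempty, compact, convex. 2) For every $j$, $f_t(\cdot,\cdot,\xi_{tj})$ is convex, proper, lower semicontinuous on $\mathcal{X}_t\times\mathcal{X}_{t-1}$, and $\mathcal{X}_t\subset\mathrm{dom}(f_t(\cdot,x_{t-1},\xi_{tj}))$ for every $x_{t-1}\in\mathcal{X}_{t-1}^\varepsilon$. 3) For every $j$, each $g_{ti}(\cdot,\cdot,\xi_{tj})$, $i=1,\dots,p$, is convex, lower semicontinuous and finite on $\mathcal{X}_t\times\mathcal{X}_{t-1}$. 4) $X_1(x_0,\xi_1)\ne\emptyset$, and for every $t=2,\dots,T$, every $j$ and every $x_{t-1}\in\mathcal{X}_{t-1}^\varepsilon$, $\mathrm{ri}(\mathcal{X}_t)\cap X_t(x_{t-1},\xi_{tj})\ne\emptyset$. 5) For every $t\ge2$ and every $j$ there is $(x_{tj},x_{t-1\,j})\in\mathrm{ri}(\mathcal{X}_t)\times\mathcal{X}_{t-1}$ with $g_t(x_{tj},x_{t-1\,j},\xi_{tj})<0$. **ISDDP algorithm.** Error levels $\delta_t^k,\varepsilon_t^k\ge0$ are given. A $\delta$-optimal solution is a feasible point whose objective value is within $\delta$ of the optimal value. Step 0: choose affine $\mathcal{Q}_t^0:\mathcal{X}_{t-1}\to\mathbb{R}$ with $\mathcal{Q}_t^0\le\mathcal{Q}_t$, $t=2,\dots,T+1$; $\mathcal{Q}_{T+1}^k\equiv0$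 for all $k$. Set $k=1$. Step 1 (forward pass): $x_0^k=x_0$; sample $(\tilde\xi_1^k,\dots,\tilde\xi_T^k)$ from the distribution of $(\xi_1,\dots,\xi_T)$; for $t=1,\dots,T$ compute a $\delta_t^k$-optimal solution $x_t^k$ of $\min\{f_t(x_t,x_{t-1}^k,\tilde\xi_t^k)+\mathcal{Q}_{t+1}^{k-1}(x_t): x_t\in X_t(x_{t-1}^k,\tilde\xi_t^k)\}$. Step 2 (backward pass): for $t=T,\dots,2$: for $j=1,\dots,N_t$ compute an $\varepsilon_t^k$-optimal solution $x_{tj}^k$ (with $z=x_{t-1}^k$) of $$\underline{\mathfrak{Q}}_t^k(x_{t-1}^k,\xi_{tj})=\min_{x_t,z}\{f_t(x_t,z,\xi_{tj})+\mathcal{Q}_{t+1}^k(x_t): A_{tj}x_t+B_{tj}z=b_{tj},\ g_t(x_t,z,\xi_{tj})\le0,\ x_t\in\mathcal{X}_t,\ z=x_{t-1}^k\}$$ and an $\varepsilon_t^k$-optimal solution $\lambda_{tj}^k$ of the dual obtained by dualizing $z=x_{t-1}^k$, i.e. of maximizing over $\lambda$ the infimum of $f_t(x_t,z,\xi_{tj})+\mathcal{Q}_{t+1}^k(x_t)+\langle\lambda,x_{t-1}^k-z\rangle$ over $(x_t,z)$ satisfying the other constraints. Set $\beta_t^k=\sum_jp_{tj}\lambda_{tj}^k$, $\theta_t^k=\sum_jp_{tj}\big(f_t(x_{tj}^k,x_{t-1}^k,\xi_{tj})+\mathcal{Q}_{t+1}^k(x_{tj}^k)-\langle\lambda_{tj}^k,x_{t-1}^k\rangle\big)$,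 $\mathcal{C}_t^k(x_{t-1})=\theta_t^k-2\varepsilon_t^k+\langle\beta_t^k,x_{t-1}\rangle$, and $\mathcal{Q}_t^k=\max\{\mathcal{Q}_t^{k-1},\mathcal{C}_t^k\}$. Then $k\leftarrow k+1$ and return to Step 1. **Scenario tree and simulation.** The realizations of $(\xi_t)$ form a scenario tree with root $n_0$ (stage $0$), whose only child is a node $n_1$ of stage 1; $\mathcal{N}$ is the set of nodes, $C(n)$ the set of children of $n$, $p_n$ the transition probability from the parent of $n$ to $n$, $\xi_n$ the realization at $n$ (containing $A_n,B_n,b_n$). In the simulation of iteration $k$ (policy obtained at the end of iteration $k-1$): $x_{n_0}^k=x_0$ and, for $t=1,\dots,T$, every node $n$ of stage $t-1$ and every $m\in C(n)$, $x_m^k$ is a $\delta_t^k$-optimal solution of $$\underline{\mathfrak{Q}}_t^{k-1}(x_n^k,\xi_m)=\inf_{x_m}\{f_t(x_m,x_n^k,\xi_m)+\mathcal{Q}_{t+1}^{k-1}(x_m): A_mx_m+B_mx_n^k=b_m,\ g_t(x_m,x_n^k,\xi_m)\le0,\ x_m\in\mathcal{X}_t\}.$$ The decisions $x_n^k$ are determined before the scenario of iteration $k$ is sampled, and along the sampled scenario they are the forward-pass decisions: $x_t^k=x_n^k$ if the sampled scenario passes through node $n$ of stage $t$. **(H2)** $(\tilde\xi_2^k,\dots,\tilde\xi_T^k)$ is a realization of $\xi^k=(\xi_2^k,\dots,\xi_T^k)\sim(\xi_2,\dots,\xi_T)$, and $\xi^1,\xi^2,\dots$ are independent.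
   Formalization: In (H1), f_t and g_ti are assumed convex (and f_t proper) as extended-real functions on all of R^n×R^n, not only on X_t×X_{t-1}; otherwise the dual over all z can have a gap, cuts become invalid and the claim fails. Only lower semicontinuity and finiteness of g_ti stay relative to X_t×X_{t-1}. *)

theory Defs
  imports "HOL-Probability.Probability"
begin

section \<open>Extended-real-valued functions and approximate solutions\<close>

text \<open>Convexity of an extended-real-valued function on the whole space (convex epigraph); the
  library's \<^const>\<open>convex_on\<close> only covers real-valued functions.\<close>

definition ereal_convex :: "('a::real_vector \<Rightarrow> ereal) \<Rightarrow> bool" where
  "ereal_convex F \<longleftrightarrow> convex {(x, r::real). F x \<le> ereal r}"

definition ereal_proper :: "('a \<Rightarrow> ereal) \<Rightarrow> bool" where
  "ereal_proper F \<longleftrightarrow> (\<forall>x. F x \<noteq> -\<infinity>) \<and> (\<exists>x. F x \<noteq> \<infinity>)"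

text \<open>Lower semicontinuity of the restriction of \<open>F\<close> to \<open>S\<close>.\<close>

definition lsc_on :: "'a::topological_space set \<Rightarrow> ('a \<Rightarrow> ereal) \<Rightarrow> bool" where
  "lsc_on S F \<longleftrightarrow> (\<forall>x\<in>S. F x \<le> Liminf (at x within S) F)"

definition approx_min :: "real \<Rightarrow> 'a set \<Rightarrow> ('a \<Rightarrow> ereal) \<Rightarrow> 'a \<Rightarrow> bool" where
  "approx_min d S F x \<longleftrightarrow> x \<in> S \<and> F x \<le> (INF y\<in>S. F y) + ereal d"

definition approx_max :: "real \<Rightarrow> 'a set \<Rightarrow> ('a \<Rightarrow> ereal) \<Rightarrow> 'a \<Rightarrow> bool" where
  "approx_max d S F x \<longleftrightarrow> x \<in> S \<and> (SUP y\<in>S. F y) - ereal d \<le> F x"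

definition enlarge :: "real \<Rightarrow> 'a::real_normed_vector set \<Rightarrow> 'a set" where
  "enlarge e S = {x + u | x u. x \<in> S \<and> norm u \<le> e}"


section \<open>The multistage stochastic program\<close>

text \<open>Realizations are vectors of \<open>real^'K\<close>; the matrices and right-hand sides
  contained in a realization are read off by \<open>A_mat\<close>, \<open>B_mat\<close>, \<open>b_vec\<close>. The finite support of the
  stage-\<open>t\<close> variable is \<open>supp P t\<close>, and its elements themselves play the role of the indices
  \<open>j = 1, \<dots>, N\<^sub>t\<close>; \<open>prb P t v\<close> is the probability of \<open>v\<close>. In \<open>cost P t x y v\<close> and
  \<open>ineq P t i x y v\<close> the first vector argument is the stage-\<open>t\<close> decision and the second one the
  stage-\<open>(t-1)\<close> decision. \<open>state_set P 0\<close> is the singleton of the initial state (see \<open>hyp_H1\<close>).\<close>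

record ('n, 'q, 'K) msp =
  horizon :: nat
  x_init :: "real^'n"
  xi_first :: "real^'K"
  state_set :: "nat \<Rightarrow> (real^'n) set"
  cost :: "nat \<Rightarrow> real^'n \<Rightarrow> real^'n \<Rightarrow> real^'K \<Rightarrow> ereal"
  ineq_dim :: nat
  ineq :: "nat \<Rightarrow> nat \<Rightarrow> real^'n \<Rightarrow> real^'n \<Rightarrow> real^'K \<Rightarrow> ereal"
  A_mat :: "nat \<Rightarrow> real^'K \<Rightarrow> real^'n^'q"
  B_mat :: "nat \<Rightarrow> real^'K \<Rightarrow> real^'n^'q"
  b_vec :: "nat \<Rightarrow> real^'K \<Rightarrow> real^'q"
  supp :: "nat \<Rightarrow> (real^'K) set"
  prb :: "nat \<Rightarrow> real^'K \<Rightarrow> real"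

text \<open>The constraints of stage \<open>t\<close> on the pair (current decision, previous decision), without any
  restriction on the previous decision.\<close>

definition joint_feasible ::
  "('n::finite, 'q::finite, 'K::finite) msp \<Rightarrow> nat \<Rightarrow> real^'K \<Rightarrow> ((real^'n) \<times> (real^'n)) set" where
  "joint_feasible P t v =
     {(x, z). A_mat P t v *v x + B_mat P t v *v z = b_vec P t v \<and>
              (\<forall>i\<in>{1..ineq_dim P}. ineq P t i x z v \<le> 0) \<and> x \<in> state_set P t}"

definition feasible ::
  "('n::finite, 'q::finite, 'K::finite) msp \<Rightarrow> nat \<Rightarrow> real^'n \<Rightarrow> real^'K \<Rightarrow> (real^'n) set" where
  "feasible P t z v = {x. (x, z) \<in> joint_feasible P t v}"

text \<open>Optimal value of the stage-\<open>t\<close> problem at previous decision \<open>z\<close> and realization \<open>v\<close>, when the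
  future cost is \<open>V\<close>.\<close>

definition stage_value ::
  "('n::finite, 'q::finite, 'K::finite) msp \<Rightarrow> nat \<Rightarrow> (real^'n \<Rightarrow> ereal) \<Rightarrow> real^'n \<Rightarrow> real^'K \<Rightarrow> ereal"
  where
  "stage_value P t V z v = (INF x\<in>feasible P t z v. cost P t x z v + V x)"

text \<open>\<open>cost_to_go_rem P s\<close> is the expected cost-to-go when \<open>s\<close> stages remain, i.e. the function
  indexed by stage \<open>horizon P + 1 - s\<close>; the expectation is the finite sum over the support.\<close>

primrec cost_to_go_rem ::
  "('n::finite, 'q::finite, 'K::finite) msp \<Rightarrow> nat \<Rightarrow> real^'n \<Rightarrow> ereal" where
  "cost_to_go_rem P 0 = (\<lambda>z. 0)"
| "cost_to_go_rem P (Suc s) =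
     (\<lambda>z. \<Sum>v\<in>supp P (horizon P - s).
        ereal (prb P (horizon P - s) v)
          * stage_value P (horizon P - s) (cost_to_go_rem P s) z v)"

definition cost_to_go ::
  "('n::finite, 'q::finite, 'K::finite) msp \<Rightarrow> nat \<Rightarrow> real^'n \<Rightarrow> ereal" where
  "cost_to_go P t = cost_to_go_rem P (horizon P + 1 - t)"

definition optimal_value :: "('n::finite, 'q::finite, 'K::finite) msp \<Rightarrow> ereal" where
  "optimal_value P = stage_value P 1 (cost_to_go P 2) (x_init P) (xi_first P)"


section \<open>Assumptions on the problem\<close>

text \<open>Interstage independence and finite supports.\<close>

definition hyp_H ::
  "('n::finite, 'q::finite, 'K::finite) msp \<Rightarrow> 'w measure \<Rightarrow> (nat \<Rightarrow> 'w \<Rightarrow> real^'K) \<Rightarrow> bool" where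
  "hyp_H P M \<xi> \<longleftrightarrow>
     prob_space.indep_vars M (\<lambda>_. borel) \<xi> {1..horizon P} \<and>
     supp P 1 = {xi_first P} \<and>
     (\<forall>t\<in>{1..horizon P}.
        finite (supp P t) \<and>
        (AE \<omega> in M. \<xi> t \<omega> \<in> supp P t) \<and>
        (\<forall>v\<in>supp P t. prb P t v = measure M {\<omega> \<in> space M. \<xi> t \<omega> = v} \<and> prb P t v > 0))"

text \<open>Costs and constraint functions are convex as extended-real-valued functions of the pair of
  decisions on the whole space: the dual problems of the algorithm involve them outside
  \<open>\<X>\<^sub>t \<times> \<X>\<^sub>t\<^sub>-\<^sub>1\<close>. Only lower semicontinuity and finiteness are relative to that set.\<close>

definition hyp_H1 :: "('n::finite, 'q::finite, 'K::finite) msp \<Rightarrow> bool" where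
  "hyp_H1 P \<longleftrightarrow>
     state_set P 0 = {x_init P} \<and>
     (\<exists>\<epsilon>>0. \<forall>t\<in>{1..horizon P}.
        (state_set P t \<noteq> {} \<and> compact (state_set P t) \<and> convex (state_set P t)) \<and>
        (\<forall>v\<in>supp P t.
           ereal_convex (\<lambda>(x, z). cost P t x z v) \<and>
           ereal_proper (\<lambda>(x, z). cost P t x z v) \<and>
           lsc_on (state_set P t \<times> state_set P (t - 1)) (\<lambda>(x, z). cost P t x z v) \<and>
           (\<forall>z\<in>enlarge \<epsilon> (state_set P (t - 1)). \<forall>x\<in>state_set P t. cost P t x z v < \<infinity>)) \<and>
        (\<forall>v\<in>supp P t. \<forall>i\<in>{1..ineq_dim P}.
           ereal_convex (\<lambda>(x, z). ineq P t i x z v) \<and>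
           lsc_on (state_set P t \<times> state_set P (t - 1)) (\<lambda>(x, z). ineq P t i x z v) \<and>
           (\<forall>x\<in>state_set P t. \<forall>z\<in>state_set P (t - 1). \<bar>ineq P t i x z v\<bar> \<noteq> \<infinity>)) \<and>
        (t = 1 \<longrightarrow> feasible P 1 (x_init P) (xi_first P) \<noteq> {}) \<and>
        (t \<ge> 2 \<longrightarrow> (\<forall>v\<in>supp P t. \<forall>z\<in>enlarge \<epsilon> (state_set P (t - 1)).
           rel_interior (state_set P t) \<inter> feasible P t z v \<noteq> {})) \<and>
        (t \<ge> 2 \<longrightarrow> (\<forall>v\<in>supp P t.
           \<exists>x\<in>rel_interior (state_set P t). \<exists>z\<in>state_set P (t - 1).
             \<forall>i\<in>{1..ineq_dim P}. ineq P t i x z v < 0)))"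


section \<open>The ISDDP algorithm along one sequence of samples\<close>

text \<open>Objective of the backward dual: the constraint \<open>z = z0\<close> is dualized with multiplier \<open>\<mu>\<close>.\<close>

definition dual_function ::
  "('n::finite, 'q::finite, 'K::finite) msp \<Rightarrow> nat \<Rightarrow> (real^'n \<Rightarrow> real) \<Rightarrow> real^'n \<Rightarrow> real^'K
     \<Rightarrow> real^'n \<Rightarrow> ereal" where
  "dual_function P t V z0 v \<mu> =
     (INF (x, z)\<in>joint_feasible P t v. cost P t x z v + ereal (V x) + ereal (\<mu> \<bullet> (z0 - z)))"

text \<open>Step 0: \<open>Q0 t\<close> is affine on \<open>\<X>\<^sub>t\<^sub>-\<^sub>1\<close> and minorizes the cost-to-go there.\<close>

definition isddp_init ::
  "('n::finite, 'q::finite, 'K::finite) msp \<Rightarrow> (nat \<Rightarrow> real^'n \<Rightarrow> real) \<Rightarrow> bool" where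
  "isddp_init P Q0 \<longleftrightarrow>
     (\<forall>t\<in>{2..horizon P + 1}.
        (\<exists>a b. \<forall>x\<in>state_set P (t - 1). Q0 t x = a + b \<bullet> x) \<and>
        (\<forall>x\<in>state_set P (t - 1). ereal (Q0 t x) \<le> cost_to_go P t x))"

text \<open>Step 1 of iteration \<open>k\<close>, with sampled realizations \<open>s t\<close>, previous approximations \<open>Qp t\<close> and
  decisions \<open>x t\<close>.\<close>

definition forward_pass ::
  "('n::finite, 'q::finite, 'K::finite) msp \<Rightarrow> (nat \<Rightarrow> real) \<Rightarrow> (nat \<Rightarrow> real^'K)
     \<Rightarrow> (nat \<Rightarrow> real^'n \<Rightarrow> real) \<Rightarrow> (nat \<Rightarrow> real^'n) \<Rightarrow> bool" where
  "forward_pass P \<delta> s Qp x \<longleftrightarrow>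
     s 1 = xi_first P \<and> x 0 = x_init P \<and>
     (\<forall>t\<in>{1..horizon P}.
        approx_min (\<delta> t) (feasible P t (x (t - 1)) (s t))
          (\<lambda>y. cost P t y (x (t - 1)) (s t) + ereal (Qp (t + 1) y)) (x t))"

text \<open>Step 2 of iteration \<open>k\<close>: \<open>x\<close> are the trial points of the forward pass, \<open>xb t v\<close> and \<open>lam t v\<close>
  the approximate primal and dual solutions for realization \<open>v\<close>, \<open>Qp\<close> and \<open>Qn\<close> the approximations
  before and after the iteration.\<close>

definition backward_pass ::
  "('n::finite, 'q::finite, 'K::finite) msp \<Rightarrow> (nat \<Rightarrow> real) \<Rightarrow> (nat \<Rightarrow> real^'n)
     \<Rightarrow> (nat \<Rightarrow> real^'K \<Rightarrow> real^'n) \<Rightarrow> (nat \<Rightarrow> real^'K \<Rightarrow> real^'n)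
     \<Rightarrow> (nat \<Rightarrow> real^'n \<Rightarrow> real) \<Rightarrow> (nat \<Rightarrow> real^'n \<Rightarrow> real) \<Rightarrow> bool" where
  "backward_pass P \<epsilon> x xb lam Qp Qn \<longleftrightarrow>
     (\<forall>t\<in>{2..horizon P}.
        (\<forall>v\<in>supp P t.
           approx_min (\<epsilon> t) {(y, z). (y, z) \<in> joint_feasible P t v \<and> z = x (t - 1)}
             (\<lambda>(y, z). cost P t y z v + ereal (Qn (t + 1) y)) (xb t v, x (t - 1)) \<and>
           approx_max (\<epsilon> t) UNIV (dual_function P t (Qn (t + 1)) (x (t - 1)) v) (lam t v)) \<and>
        (let \<beta> = (\<Sum>v\<in>supp P t. prb P t v *\<^sub>R lam t v);
             \<theta> = (\<Sum>v\<in>supp P t. prb P t v *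
                    (real_of_ereal (cost P t (xb t v) (x (t - 1)) v) + Qn (t + 1) (xb t v)
                      - lam t v \<bullet> x (t - 1)))
         in \<forall>y\<in>state_set P (t - 1). Qn t y = max (Qp t y) (\<theta> - 2 * \<epsilon> t + \<beta> \<bullet> y)))"

text \<open>Error levels are indexed as \<open>\<delta> t k\<close>, \<open>\<epsilon> t k\<close>, approximations as \<open>Q k t\<close>, and the samples,
  trial points and backward solutions as \<open>s k t\<close>, \<open>xf k t\<close>, \<open>xb k t v\<close>, \<open>lam k t v\<close>. The values of
  \<open>Q k t\<close> outside \<open>\<X>\<^sub>t\<^sub>-\<^sub>1\<close> are irrelevant.\<close>

definition isddp_run ::
  "('n::finite, 'q::finite, 'K::finite) msp \<Rightarrow> (nat \<Rightarrow> nat \<Rightarrow> real) \<Rightarrow> (nat \<Rightarrow> nat \<Rightarrow> real)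
     \<Rightarrow> (nat \<Rightarrow> real^'n \<Rightarrow> real) \<Rightarrow> (nat \<Rightarrow> nat \<Rightarrow> real^'K) \<Rightarrow> (nat \<Rightarrow> nat \<Rightarrow> real^'n)
     \<Rightarrow> (nat \<Rightarrow> nat \<Rightarrow> real^'K \<Rightarrow> real^'n) \<Rightarrow> (nat \<Rightarrow> nat \<Rightarrow> real^'K \<Rightarrow> real^'n)
     \<Rightarrow> (nat \<Rightarrow> nat \<Rightarrow> real^'n \<Rightarrow> real) \<Rightarrow> bool" where
  "isddp_run P \<delta> \<epsilon> Q0 s xf xb lam Q \<longleftrightarrow>
     (\<forall>t\<in>{2..horizon P + 1}. \<forall>x\<in>state_set P (t - 1). Q 0 t x = Q0 t x) \<and>
     (\<forall>k. \<forall>x\<in>state_set P (horizon P). Q k (horizon P + 1) x = 0) \<and>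
     (\<forall>k\<ge>1. forward_pass P (\<lambda>t. \<delta> t k) (s k) (Q (k - 1)) (xf k) \<and>
             backward_pass P (\<lambda>t. \<epsilon> t k) (xf k) (xb k) (lam k) (Q (k - 1)) (Q k))"


section \<open>Scenario tree and simulation\<close>

text \<open>A node of stage \<open>t\<close> is the list of the \<open>t\<close> realizations leading to it; the root is the empty
  list and the children of \<open>n\<close> are the nodes \<open>n @ [v]\<close> with \<open>v\<close> in the support of the next stage.\<close>

definition nodes :: "('n::finite, 'q::finite, 'K::finite) msp \<Rightarrow> nat \<Rightarrow> (real^'K) list set" where
  "nodes P t = {n. length n = t \<and> (\<forall>r<t. n ! r \<in> supp P (Suc r))}"

definition simulation ::
  "('n::finite, 'q::finite, 'K::finite) msp \<Rightarrow> (nat \<Rightarrow> nat \<Rightarrow> real) \<Rightarrow> (nat \<Rightarrow> nat \<Rightarrow> real^'n \<Rightarrow> real)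
     \<Rightarrow> (nat \<Rightarrow> (real^'K) list \<Rightarrow> real^'n) \<Rightarrow> bool" where
  "simulation P \<delta> Q xn \<longleftrightarrow>
     (\<forall>k\<ge>1. xn k [] = x_init P \<and>
        (\<forall>t\<in>{1..horizon P}. \<forall>n\<in>nodes P (t - 1). \<forall>v\<in>supp P t.
           approx_min (\<delta> t k) (feasible P t (xn k n) v)
             (\<lambda>y. cost P t y (xn k n) v + ereal (Q (k - 1) (t + 1) y)) (xn k (n @ [v]))))"

definition passes_through :: "(nat \<Rightarrow> real^'K) \<Rightarrow> (real^'K) list \<Rightarrow> bool" where
  "passes_through s n \<longleftrightarrow> n = map s [1..<Suc (length n)]"

text \<open>Along the sampled scenarios, the forward-pass decisions are those of the simulation.\<close>

definition coupled ::
  "('n::finite, 'q::finite, 'K::finite) msp \<Rightarrow> (nat \<Rightarrow> nat \<Rightarrow> real^'K) \<Rightarrow> (nat \<Rightarrow> nat \<Rightarrow> real^'n)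
     \<Rightarrow> (nat \<Rightarrow> (real^'K) list \<Rightarrow> real^'n) \<Rightarrow> bool" where
  "coupled P s xf xn \<longleftrightarrow>
     (\<forall>k\<ge>1. \<forall>t\<le>horizon P. \<forall>n\<in>nodes P t. passes_through (s k) n \<longrightarrow> xf k t = xn k n)"


section \<open>Sampling assumptions\<close>

text \<open>The sampled scenarios of iterations \<open>k = 1, 2, \<dots>\<close> are independent copies of the process from
  stage 2 on.\<close>

definition hyp_H2 ::
  "('n::finite, 'q::finite, 'K::finite) msp \<Rightarrow> 'w measure \<Rightarrow> (nat \<Rightarrow> 'w \<Rightarrow> real^'K)
     \<Rightarrow> (nat \<Rightarrow> nat \<Rightarrow> 'w \<Rightarrow> real^'K) \<Rightarrow> bool" where
  "hyp_H2 P M \<xi> \<xi>s \<longleftrightarrow>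
     prob_space.indep_vars M (\<lambda>k. Pi\<^sub>M {2..horizon P} (\<lambda>_. borel))
       (\<lambda>k \<omega>. \<lambda>t\<in>{2..horizon P}. \<xi>s k t \<omega>) {1..} \<and>
     (\<forall>k\<ge>1. distr M (Pi\<^sub>M {2..horizon P} (\<lambda>_. borel)) (\<lambda>\<omega>. \<lambda>t\<in>{2..horizon P}. \<xi>s k t \<omega>)
            = distr M (Pi\<^sub>M {2..horizon P} (\<lambda>_. borel)) (\<lambda>\<omega>. \<lambda>t\<in>{2..horizon P}. \<xi> t \<omega>))"

definition same_samples ::
  "('n::finite, 'q::finite, 'K::finite) msp \<Rightarrow> (nat \<Rightarrow> nat \<Rightarrow> 'w \<Rightarrow> real^'K) \<Rightarrow> nat \<Rightarrow> 'w \<Rightarrow> 'w \<Rightarrow> bool" where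
  "same_samples P \<xi>s k \<omega> \<omega>' \<longleftrightarrow>
     (\<forall>i\<in>{1..k}. \<forall>t\<in>{2..horizon P}. \<xi>s i t \<omega> = \<xi>s i t \<omega>')"

text \<open>The node decisions of iteration \<open>k\<close> are determined before the scenario of iteration \<open>k\<close> is
  sampled (by the samples of the earlier iterations), and the outcome of the backward pass of
  iteration \<open>k\<close> before the scenario of iteration \<open>k + 1\<close> is sampled.\<close>

definition nonanticipative ::
  "('n::finite, 'q::finite, 'K::finite) msp \<Rightarrow> 'w measure \<Rightarrow> (nat \<Rightarrow> nat \<Rightarrow> 'w \<Rightarrow> real^'K)
     \<Rightarrow> (nat \<Rightarrow> (real^'K) list \<Rightarrow> 'w \<Rightarrow> real^'n) \<Rightarrow> (nat \<Rightarrow> nat \<Rightarrow> real^'K \<Rightarrow> 'w \<Rightarrow> real^'n)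
     \<Rightarrow> (nat \<Rightarrow> nat \<Rightarrow> real^'K \<Rightarrow> 'w \<Rightarrow> real^'n) \<Rightarrow> bool" where
  "nonanticipative P M \<xi>s xn xb lam \<longleftrightarrow>
     (\<forall>k\<ge>1. \<forall>\<omega>\<in>space M. \<forall>\<omega>'\<in>space M.
        (same_samples P \<xi>s (k - 1) \<omega> \<omega>' \<longrightarrow>
           (\<forall>t\<le>horizon P. \<forall>n\<in>nodes P t. xn k n \<omega> = xn k n \<omega>')) \<and>
        (same_samples P \<xi>s k \<omega> \<omega>' \<longrightarrow>
           (\<forall>t\<in>{2..horizon P}. \<forall>v\<in>supp P t. xb k t v \<omega> = xb k t v \<omega>' \<and> lam k t v \<omega> = lam k t v \<omega>')))"

definition accumulation_point :: "(nat \<Rightarrow> 'a::topological_space) \<Rightarrow> 'a \<Rightarrow> bool" where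
  "accumulation_point x l \<longleftrightarrow> (\<exists>r::nat \<Rightarrow> nat. strict_mono r \<and> (x \<circ> r) \<longlonglongrightarrow> l)"

end

theory Submission
  imports Defs
begin

text \<open>
  Fix a stage \<open>t\<close> and a realization, and regard the stage problem as a convex program whose parameter is
  the previous decision. The problem is feasible with finite cost for parameters in a neighbourhood of
  the state set, so its value function is finite and convex there. Separation from its epigraph yields
  subgradients, hence strong duality for the dualized constraint, and an \<open>\<epsilon>\<close>-optimal
  dual solution is an \<open>\<epsilon>\<close>-subgradient (\<open>approx_dual_solution_subgradient\<close>). A step of fixed length in
  its direction stays in the neighbourhood, which bounds it independently of the iteration
  (\<open>approx_dual_solution_bounded\<close>). Consequently the cuts are minorants of the cost-to-go functions, are
  uniformly Lipschitz, and are tight up to \<open>2 \<epsilon>\<close> at the trial points (\<open>cut_bounds\<close>). The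
  approximations increase, are equi-Lipschitz and bounded above by the cost-to-go functions; so they
  converge uniformly to continuous functions, on every sample path (\<open>Qlim\<close>).

  It remains to show that at each node the gap between the cost-to-go function and its approximation,
  taken at the decision of the node, tends to \<open>0\<close>. This is done backwards in the stages, starting from the
  known function \<open>0\<close> after the horizon. At iterations whose scenario visits the node, the new cut bounds
  the gap by the gaps at the children plus the error levels (\<open>visited_node_gap\<close>). At the
  other iterations a probabilistic argument is used. Whether the gap exceeds a level at iteration \<open>k\<close> is
  determined by the samples before \<open>k\<close>, and the sample of iteration \<open>k\<close>, independent of them, visits the node
  with a fixed positive probability. A conditional Borel--Cantelli lemma (\<open>predictable_infinitely_often\<close>)
  shows that almost surely, if the level is exceeded infinitely often, then it is exceeded infinitely
  often at visits. There the gap tends to \<open>0\<close>, as uniform convergence makes one more cut negligible;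
  so it tends to \<open>0\<close> along all iterations (\<open>gap_tendsto_0\<close>).

  Vanishing gaps give both conclusions. The gap at the only node of stage 1 controls the approximate
  optimal value (\<open>first_stage_limit\<close>). At an accumulation point of node decisions, uniform convergence
  and continuity turn the vanishing gap into equality (\<open>Qlim_at_accumulation_point\<close>).
\<close>

section \<open>Semicontinuity, extended-real convexity and enlargements\<close>

text \<open>Each point has a neighbourhood on which \<open>F\<close> stays above a real number; finitely many of them cover \<open>S\<close>.\<close>

lemma lsc_on_compact_bounded_below:
  assumes "compact S" and "lsc_on S F" and "\<And>x. x \<in> S \<Longrightarrow> F x \<noteq> -\<infinity>"
  shows "\<exists>m::real. \<forall>x\<in>S. ereal m \<le> F x"
proof -
  have "\<exists>U m. open U \<and> x \<in> U \<and> (\<forall>y\<in>U \<inter> S. ereal m \<le> F y)" if "x \<in> S" for x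
  proof -
    obtain m where m: "ereal m < F x"
    proof (cases "F x")
      case (real r)
      then show thesis by (intro that[of "r - 1"]) simp
    next
      case PInf
      then show thesis by (intro that[of 0]) simp
    qed (use assms(3) \<open>x \<in> S\<close> in auto)
    then have "ereal m < Liminf (at x within S) F"
      using assms(2) that unfolding lsc_on_def by (metis order_less_le_trans)
    then have "eventually (\<lambda>y. ereal m < F y) (at x within S)"
      by (rule less_LiminfD)
    then obtain U where "open U" "x \<in> U" "\<forall>y\<in>U. y \<noteq> x \<longrightarrow> y \<in> S \<longrightarrow> ereal m < F y"
      unfolding eventually_at_topological by blast
    with m show ?thesis
      by (intro exI[of _ U] exI[of _ m]) (auto intro: less_imp_le)
  qed
  then obtain U m where U: "\<And>x. x \<in> S \<Longrightarrow> open (U x) \<and> x \<in> U x \<and> (\<forall>y\<in>U x \<inter> S. ereal (m x) \<le> F y)"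
    by metis
  obtain C where C: "C \<subseteq> S" "finite C" "S \<subseteq> (\<Union>x\<in>C. U x)"
    by (rule compactE_image[OF assms(1), of S U]) (use U in auto)
  show ?thesis
  proof (intro exI ballI)
    fix y assume "y \<in> S"
    then obtain x where x: "x \<in> C" "y \<in> U x" using C by blast
    have "Min (m ` C) \<le> m x" using x C by simp
    moreover have "ereal (m x) \<le> F y" using U x \<open>y \<in> S\<close> C by blast
    ultimately show "ereal (Min (m ` C)) \<le> F y" by (meson ereal_less_eq(3) order_trans)
  qed
qed

lemma ereal_convexD:
  assumes "ereal_convex F" "F p \<le> ereal r" "F q \<le> ereal s" "0 \<le> u" "0 \<le> v" "u + v = 1"
  shows "F (u *\<^sub>R p + v *\<^sub>R q) \<le> ereal (u * r + v * s)"
  using convexD[OF assms(1)[unfolded ereal_convex_def], of "(p, r)" "(q, s)" u v] assms(2-)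
  by simp

lemma convex_sublevel_ereal:
  assumes "ereal_convex F"
  shows "convex {p. F p \<le> 0}"
proof (rule convexI)
  fix p q and u v :: real
  assume "p \<in> {p. F p \<le> 0}" "q \<in> {p. F p \<le> 0}" "0 \<le> u" "0 \<le> v" "u + v = 1"
  then show "u *\<^sub>R p + v *\<^sub>R q \<in> {p. F p \<le> 0}"
    using ereal_convexD[OF assms, of p 0 q 0 u v] by (simp add: zero_ereal_def)
qed

lemma mem_enlarge_iff: "z \<in> enlarge e S \<longleftrightarrow> (\<exists>x\<in>S. dist x z \<le> e)"
proof
  assume "\<exists>x\<in>S. dist x z \<le> e"
  then obtain x where "x \<in> S" "dist x z \<le> e" by blast
  then have "z = x + (z - x)" "norm (z - x) \<le> e" by (auto simp: dist_norm norm_minus_commute)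
  then show "z \<in> enlarge e S" using \<open>x \<in> S\<close> unfolding enlarge_def by blast
next
  assume "z \<in> enlarge e S"
  then obtain x u where "z = x + u" "x \<in> S" "norm u \<le> e" unfolding enlarge_def by blast
  then show "\<exists>x\<in>S. dist x z \<le> e" by (intro bexI[of _ x]) (simp_all add: dist_norm)
qed

lemma subset_enlarge: "0 \<le> e \<Longrightarrow> S \<subseteq> enlarge e S"
  by (metis dist_self mem_enlarge_iff subsetI)

lemma enlarge_eq: "enlarge e S = (\<Union>x\<in>S. cball x e)"
  by (auto simp: mem_enlarge_iff)

lemma enlarge_mono: "d \<le> e \<Longrightarrow> enlarge d S \<subseteq> enlarge e S"
  unfolding enlarge_eq by (intro UN_mono order_refl) (simp add: subset_iff)

lemma sum_ball_eq:
  fixes S :: "'a::real_normed_vector set"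
  shows "(\<Union>x\<in>S. \<Union>y\<in>ball 0 e. {x + y}) = (\<Union>x\<in>S. ball x e)"
    and "(\<Union>x\<in>S. \<Union>y\<in>cball 0 e. {x + y}) = (\<Union>x\<in>S. cball x e)"
proof -
  have "(\<Union>y\<in>ball 0 e. {x + y}) = ball x e" "(\<Union>y\<in>cball 0 e. {x + y}) = cball x e" for x :: 'a
    using ball_translation[of x 0 e] cball_translation[of x 0 e] by (simp_all add: UNION_singleton_eq_range)
  then show "(\<Union>x\<in>S. \<Union>y\<in>ball 0 e. {x + y}) = (\<Union>x\<in>S. ball x e)"
    and "(\<Union>x\<in>S. \<Union>y\<in>cball 0 e. {x + y}) = (\<Union>x\<in>S. cball x e)"
    by simp_all
qed

lemma compact_enlarge:
  fixes S :: "'a::euclidean_space set"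
  assumes "compact S"
  shows "compact (enlarge e S)"
  using compact_sums'[OF assms compact_cball[of 0 e]] by (simp add: sum_ball_eq enlarge_eq)

lemma convex_enlarge:
  fixes S :: "'a::real_normed_vector set"
  assumes "convex S"
  shows "convex (enlarge e S)"
  using convex_sums[OF assms convex_cball[of 0 e]] by (simp add: sum_ball_eq enlarge_eq)

lemma open_neighbourhood_in_enlarge:
  fixes S :: "'a::real_normed_vector set"
  assumes "convex S" "0 < e"
  obtains U where "open U" "convex U" "enlarge (e / 2) S \<subseteq> U" "U \<subseteq> enlarge e S"
proof
  let ?U = "\<Union>x\<in>S. ball x e"
  show "convex ?U" using convex_sums[OF assms(1) convex_ball[of 0 e]] by (simp add: sum_ball_eq)
  show "open ?U" by blast
  have "cball x (e / 2) \<subseteq> ball x e" for x :: 'a using assms(2) by (simp add: subset_iff)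
  then show "enlarge (e / 2) S \<subseteq> ?U" unfolding enlarge_eq by blast
  show "?U \<subseteq> enlarge e S" unfolding enlarge_eq using ball_subset_cball by blast
qed

section \<open>Value functions of convex parametric programs\<close>

text \<open>A convex program in \<open>x\<close> with parameter \<open>z\<close>, in the shape of one stage of the multistage problem:
  \<open>J\<close> is the joint feasible set and the future cost \<open>V\<close> is added to \<open>c\<close> as an argument of the value
  function. The program is feasible with finite cost on the enlargement of the parameter set \<open>Z\<close>,
  which makes every point of \<open>Z\<close> interior to the domain of the value function. The lower bound \<open>m\<close>
  holds for parameters in \<open>Z\<close> only, because costs are lower semicontinuous only there.\<close>

locale parametric_program =
  fixes X :: "'a::euclidean_space set" and Z :: "'b::euclidean_space set"
    and J :: "('a \<times> 'b) set" and c :: "'a \<Rightarrow> 'b \<Rightarrow> ereal" and e m :: real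
  assumes e_pos: "0 < e"
    and Z_ne: "Z \<noteq> {}" and Z_compact: "compact Z" and Z_convex: "convex Z"
    and J_convex: "convex J" and J_X: "\<And>x z. (x, z) \<in> J \<Longrightarrow> x \<in> X"
    and J_ne: "\<And>z. z \<in> enlarge e Z \<Longrightarrow> \<exists>x. (x, z) \<in> J"
    and c_convex: "ereal_convex (\<lambda>(x, z). c x z)"
    and c_not_MInf: "\<And>x z. c x z \<noteq> -\<infinity>"
    and c_finite: "\<And>x z. x \<in> X \<Longrightarrow> z \<in> enlarge e Z \<Longrightarrow> c x z < \<infinity>"
    and c_lower: "\<And>x z. x \<in> X \<Longrightarrow> z \<in> Z \<Longrightarrow> ereal m \<le> c x z"
begin

definition val :: "('a \<Rightarrow> real) \<Rightarrow> 'b \<Rightarrow> ereal" where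
  "val V z = (INF x\<in>{x. (x, z) \<in> J}. c x z + ereal (V x))"

definition rval :: "('a \<Rightarrow> real) \<Rightarrow> 'b \<Rightarrow> real" where
  "rval V z = real_of_ereal (val V z)"

definition dualf :: "('a \<Rightarrow> real) \<Rightarrow> 'b \<Rightarrow> 'b \<Rightarrow> ereal" where
  "dualf V z0 \<mu> = (INF (x, z)\<in>J. c x z + ereal (V x) + ereal (\<mu> \<bullet> (z0 - z)))"

lemma Z_enlarge: "z \<in> Z \<Longrightarrow> z \<in> enlarge e Z"
  using subset_enlarge[of e Z] e_pos by auto

lemma val_le: "(x, z) \<in> J \<Longrightarrow> val V z \<le> c x z + ereal (V x)"
  unfolding val_def by (rule INF_lower) simp

text \<open>The strict epigraph of a value function is the projection of a convex set, hence convex. The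
  strict form avoids any question of attainment, and it makes sense for infinite values.\<close>

lemma val_less_convex:
  assumes V: "convex_on X V" and "val V z < ereal r" "val V z' < ereal r'"
    and uv: "0 \<le> u" "0 \<le> v" "u + v = (1::real)"
  shows "val V (u *\<^sub>R z + v *\<^sub>R z') < ereal (u * r + v * r')"
proof -
  have attain: "\<exists>x q. (x, z) \<in> J \<and> c x z = ereal q \<and> q + V x < r" if less: "val V z < ereal r" for z r
  proof -
    obtain x where x: "(x, z) \<in> J" "c x z + ereal (V x) < ereal r"
      using less unfolding val_def INF_less_iff by blast
    with c_not_MInf[of x z] show ?thesis by (cases "c x z") auto
  qed
  obtain x q where x: "(x, z) \<in> J" "c x z = ereal q" "q + V x < r"
    using attain[OF assms(2)] by blast
  obtain x' q' where x': "(x', z') \<in> J" "c x' z' = ereal q'" "q' + V x' < r'"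
    using attain[OF assms(3)] by blast
  let ?x = "u *\<^sub>R x + v *\<^sub>R x'" and ?z = "u *\<^sub>R z + v *\<^sub>R z'"
  have J: "(?x, ?z) \<in> J" using convexD[OF J_convex x(1) x'(1) uv] by simp
  have cle: "c ?x ?z \<le> ereal (u * q + v * q')"
    using ereal_convexD[OF c_convex, of "(x, z)" q "(x', z')" q' u v] x x' uv by simp
  have "V ?x \<le> u * V x + v * V x'"
    using V J_X[OF x(1)] J_X[OF x'(1)] uv by (simp add: convex_on_def)
  then have "val V ?z \<le> ereal (u * q + v * q') + ereal (u * V x + v * V x')"
    by (intro order_trans[OF val_le[OF J]] add_mono cle) simp
  also have "\<dots> < ereal (u * r + v * r')"
  proof -
    have "u * (q + V x) + v * (q' + V x') < u * r + v * r'"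
    proof (cases "u = 0")
      case True then show ?thesis using uv x' by simp
    next
      case False
      then have "u * (q + V x) < u * r" using x uv by simp
      moreover have "v * (q' + V x') \<le> v * r'" using x' uv by (simp add: mult_left_mono)
      ultimately show ?thesis by linarith
    qed
    then show ?thesis by (simp add: algebra_simps)
  qed
  finally show ?thesis .
qed

lemma val_less_PInf: "z \<in> enlarge e Z \<Longrightarrow> val V z < \<infinity>"
proof -
  assume z: "z \<in> enlarge e Z"
  then obtain x where x: "(x, z) \<in> J" using J_ne by blast
  have "val V z \<le> c x z + ereal (V x)" by (rule val_le[OF x])
  also have "\<dots> < \<infinity>" using c_finite[OF J_X[OF x] z] by (cases "c x z") auto
  finally show ?thesis .
qed

lemma val_lower:
  assumes "z \<in> Z" "\<forall>x\<in>X. l \<le> V x"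
  shows "ereal (m + l) \<le> val V z"
  unfolding val_def
proof (rule INF_greatest, clarify)
  fix x assume "(x, z) \<in> J"
  then have "ereal m \<le> c x z" "ereal l \<le> ereal (V x)" using c_lower J_X assms by auto
  then show "ereal (m + l) \<le> c x z + ereal (V x)" by (metis add_mono plus_ereal.simps(1))
qed

text \<open>The cost is bounded below only for parameters in \<open>Z\<close>. If the value were \<open>-\<infinity>\<close> at some \<open>z\<close>, extend the
  segment from \<open>z\<close> through a point \<open>z0\<close> of \<open>Z\<close> a little beyond \<open>z0\<close>: convexity along it would make the
  value at \<open>z0\<close> arbitrarily small, against the bound on \<open>Z\<close>.\<close>

lemma val_not_MInf:
  assumes V: "convex_on X V" and l: "\<forall>x\<in>X. l \<le> V x"
  shows "val V z \<noteq> -\<infinity>"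
proof
  assume inf: "val V z = -\<infinity>"
  obtain z0 where z0: "z0 \<in> Z" using Z_ne by blast
  define s where "s = e / (1 + norm (z0 - z))"
  have s: "s > 0" "s * norm (z0 - z) \<le> e"
    using e_pos by (auto simp: s_def field_simps add_pos_nonneg)
  define z' where "z' = z0 + s *\<^sub>R (z0 - z)"
  have "z' \<in> enlarge e Z"
    using z0 s by (auto simp: mem_enlarge_iff z'_def dist_norm intro!: bexI[of _ z0])
  then have "val V z' < \<infinity>" by (rule val_less_PInf)
  then obtain r' where r': "val V z' < ereal r'"
    using less_PInf_Ex_of_nat by auto
  \<comment> \<open>the level at \<open>z\<close> for which convexity yields a value below \<open>m + l\<close> at \<open>z0\<close>\<close>
  define r where "r = ((1 + s) * (m + l) - r') / s"
  have "val V ((s / (1+s)) *\<^sub>R z + (1/(1+s)) *\<^sub>R z') < ereal (s / (1+s) * r + 1/(1+s) * r')"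
    by (rule val_less_convex[OF V]) (use inf r' s in \<open>auto simp: field_simps\<close>)
  moreover have "(s / (1+s)) *\<^sub>R z + (1/(1+s)) *\<^sub>R z' = z0"
  proof -
    have "(s / (1+s)) *\<^sub>R z + (1/(1+s)) *\<^sub>R z' = (1/(1+s)) *\<^sub>R (s *\<^sub>R z + z')"
      by (simp add: scaleR_add_right)
    also have "s *\<^sub>R z + z' = (1 + s) *\<^sub>R z0"
      by (simp add: z'_def algebra_simps)
    finally show ?thesis using s by simp
  qed
  moreover have "s / (1+s) * r + 1/(1+s) * r' = m + l"
  proof -
    have "s * r = (1 + s) * (m + l) - r'" using s by (simp add: r_def)
    then have "(s * r + r') / (1 + s) = m + l" using s by simp
    then show ?thesis by (simp add: add_divide_distrib)
  qed
  ultimately have "val V z0 < ereal (m + l)" by simp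
  with val_lower[OF z0 l] show False by auto
qed

lemma val_eq_rval:
  assumes V: "convex_on X V" and l: "\<forall>x\<in>X. l \<le> V x" and z: "z \<in> enlarge e Z"
  shows "val V z = ereal (rval V z)"
  using val_less_PInf[OF z, of V] val_not_MInf[OF V l, of z]
  unfolding rval_def by (cases "val V z") auto

lemma convex_rval:
  assumes V: "convex_on X V" and l: "\<forall>x\<in>X. l \<le> V x"
  shows "convex_on (enlarge e Z) (rval V)"
proof (rule convex_onI)
  show cv: "convex (enlarge e Z)" by (rule convex_enlarge[OF Z_convex])
  fix t :: real and x y assume t: "0 < t" "t < 1" and x: "x \<in> enlarge e Z" and y: "y \<in> enlarge e Z"
  let ?z = "(1 - t) *\<^sub>R x + t *\<^sub>R y"
  have z: "?z \<in> enlarge e Z" using convexD[OF cv x y, of "1-t" t] t by simp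
  have "rval V ?z \<le> (1 - t) * rval V x + t * rval V y + d" if "d > 0" for d
  proof -
    have "val V ?z < ereal ((1 - t) * (rval V x + d) + t * (rval V y + d))"
      by (rule val_less_convex[OF V])
        (use t that val_eq_rval[OF V l] x y in auto)
    then show ?thesis using val_eq_rval[OF V l z] by (simp add: algebra_simps)
  qed
  then show "rval V ?z \<le> (1 - t) * rval V x + t * rval V y"
    by (rule field_le_epsilon)
qed

text \<open>A finite convex function is continuous on open sets, so passing to half of the enlargement gives
  continuity, and a bound by compactness.\<close>

lemma rval_continuous_bounded:
  assumes V: "convex_on X V" and l: "\<forall>x\<in>X. l \<le> V x"
  shows "continuous_on (enlarge (e/2) Z) (rval V)"
    and "\<exists>K. \<forall>z\<in>enlarge (e/2) Z. rval V z \<le> K"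
proof -
  obtain U where U: "open U" "convex U" "enlarge (e / 2) Z \<subseteq> U" "U \<subseteq> enlarge e Z"
    using open_neighbourhood_in_enlarge[OF Z_convex e_pos] .
  have "continuous_on U (rval V)"
    using convex_on_continuous[OF U(1)] convex_on_subset[OF convex_rval[OF V l] U(4) U(2)] by simp
  then show *: "continuous_on (enlarge (e/2) Z) (rval V)"
    using U continuous_on_subset by blast
  have "bounded (rval V ` enlarge (e/2) Z)"
    by (intro compact_imp_bounded compact_continuous_image * compact_enlarge Z_compact)
  then show "\<exists>K. \<forall>z\<in>enlarge (e/2) Z. rval V z \<le> K"
    by (metis bounded_real abs_le_D1 imageI)
qed

text \<open>The point \<open>(z0, val V z0)\<close> is separated from the strict epigraph. The separating hyperplane is not
  vertical, as \<open>z0\<close> is interior to the domain; its slope is the subgradient. This is strong duality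
  for the constraint \<open>z = z0\<close>, with an attained dual maximum.\<close>

lemma subgradient_exists:
  assumes V: "convex_on X V" and l: "\<forall>x\<in>X. l \<le> V x" and z0: "z0 \<in> Z"
  shows "\<exists>\<mu>. \<forall>z. ereal (rval V z0 + \<mu> \<bullet> (z - z0)) \<le> val V z"
proof -
  let ?w = "rval V z0"
  have w: "val V z0 = ereal ?w" using val_eq_rval[OF V l] Z_enlarge[OF z0] by blast
  let ?E = "{(z, r). val V z < ereal r}"
  have "convex ?E"
  proof (rule convexI)
    fix p q and u v :: real
    assume "p \<in> ?E" "q \<in> ?E" "0 \<le> u" "0 \<le> v" "u + v = 1"
    then show "u *\<^sub>R p + v *\<^sub>R q \<in> ?E"
      using val_less_convex[OF V, of "fst p" "snd p" "fst q" "snd q" u v] by (auto simp: case_prod_beta)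
  qed
  moreover have "(z0, ?w + 1) \<in> ?E" using w by simp
  moreover have "(z0, ?w) \<notin> ?E" using w by simp
  ultimately obtain a b where ab: "a \<noteq> 0" "\<forall>p\<in>{(z0, ?w)}. a \<bullet> p \<le> b" "\<forall>p\<in>?E. b \<le> a \<bullet> p"
    using separating_hyperplane_sets[of "{(z0, ?w)}" ?E] by blast
  obtain g \<alpha> where a: "a = (g, \<alpha>)" by (cases a)
  have sep: "g \<bullet> z0 + \<alpha> * ?w \<le> g \<bullet> z + \<alpha> * r" if "val V z < ereal r" for z r
    using ab that unfolding a by fastforce
  have "\<alpha> \<ge> 0" using sep[of z0 "?w + 1"] w by (simp add: algebra_simps)
  moreover have "\<alpha> \<noteq> 0"
  proof
    assume "\<alpha> = 0"
    then have "g \<noteq> 0" using ab a by (simp add: zero_prod_def)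
    let ?z = "z0 - (e / norm g) *\<^sub>R g"
    have "?z \<in> enlarge e Z" using z0 e_pos \<open>g \<noteq> 0\<close>
      by (auto simp: mem_enlarge_iff dist_norm intro!: bexI[of _ z0])
    then obtain r where "val V ?z < ereal r" using val_less_PInf less_PInf_Ex_of_nat by (metis less_irrefl)
    from sep[OF this] \<open>\<alpha> = 0\<close> have "0 \<le> - (e / norm g) * (g \<bullet> g)" by (simp add: inner_diff_right)
    moreover have "0 < e / norm g * (g \<bullet> g)" using e_pos \<open>g \<noteq> 0\<close> by simp
    ultimately show False by simp
  qed
  ultimately have \<alpha>: "\<alpha> > 0" by simp
  show ?thesis
  proof (intro exI allI)
    fix z
    show "ereal (?w + (- (1/\<alpha>) *\<^sub>R g) \<bullet> (z - z0)) \<le> val V z"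
    proof (rule dense_ge)
      fix y assume "val V z < y"
      then show "ereal (?w + (- (1/\<alpha>) *\<^sub>R g) \<bullet> (z - z0)) \<le> y"
      proof (cases y)
        case (real r)
        then have "g \<bullet> z0 + \<alpha> * ?w \<le> g \<bullet> z + \<alpha> * r" using sep \<open>val V z < y\<close> by simp
        then have "?w - (g \<bullet> (z - z0)) / \<alpha> \<le> r" using \<alpha> by (simp add: field_simps inner_diff_right)
        then show ?thesis using real by simp
      qed auto
    qed
  qed
qed

text \<open>A subgradient has dual value at least \<open>rval V z0\<close>, so a \<open>d\<close>-optimal multiplier has dual value at least
  \<open>rval V z0 - d\<close>. Spelling out the infimum in the dual function, this says that the multiplier is a
  \<open>d\<close>-subgradient.\<close>

lemma approx_dual_solution_subgradient:
  assumes V: "convex_on X V" and l: "\<forall>x\<in>X. l \<le> V x" and z0: "z0 \<in> Z"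
    and \<mu>: "approx_max d UNIV (dualf V z0) \<mu>"
  shows "ereal (rval V z0 - d + \<mu> \<bullet> (z - z0)) \<le> val V z"
proof -
  obtain \<nu> where \<nu>: "\<And>z. ereal (rval V z0 + \<nu> \<bullet> (z - z0)) \<le> val V z"
    using subgradient_exists[OF V l z0] by blast
  have "ereal (rval V z0) \<le> dualf V z0 \<nu>"
    unfolding dualf_def
  proof (rule INF_greatest, clarify)
    fix x z assume J: "(x, z) \<in> J"
    have "ereal (rval V z0 + \<nu> \<bullet> (z - z0)) \<le> c x z + ereal (V x)"
      by (rule order_trans[OF \<nu> val_le[OF J]])
    then show "ereal (rval V z0) \<le> c x z + ereal (V x) + ereal (\<nu> \<bullet> (z0 - z))"
      using c_not_MInf[of x z] by (cases "c x z") (auto simp: inner_diff_right)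
  qed
  also have "\<dots> \<le> (SUP y. dualf V z0 y)" by (rule SUP_upper) simp
  finally have "ereal (rval V z0) - ereal d \<le> (SUP y. dualf V z0 y) - ereal d"
    by (rule ereal_minus_mono) simp
  also have "\<dots> \<le> dualf V z0 \<mu>" using \<mu> by (simp add: approx_max_def)
  finally have *: "ereal (rval V z0 - d) \<le> dualf V z0 \<mu>" by simp
  show ?thesis unfolding val_def
  proof (rule INF_greatest, clarify)
    fix x assume J: "(x, z) \<in> J"
    have "ereal (rval V z0 - d) \<le> c x z + ereal (V x) + ereal (\<mu> \<bullet> (z0 - z))"
      using * INF_lower[OF J, of "\<lambda>(x, z). c x z + ereal (V x) + ereal (\<mu> \<bullet> (z0 - z))"]
      unfolding dualf_def by auto
    then show "ereal (rval V z0 - d + \<mu> \<bullet> (z - z0)) \<le> c x z + ereal (V x)"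
      using c_not_MInf[of x z] by (cases "c x z") (auto simp: inner_diff_right)
  qed
qed

text \<open>Evaluate the \<open>d\<close>-subgradient inequality at the distance \<open>e/2\<close> from \<open>z0\<close> in the direction of \<open>\<mu>\<close>,
  where the value is at most \<open>K\<close>. The bound depends on \<open>V\<close> only through \<open>K\<close> and the lower bound \<open>l\<close>, and
  this makes the cuts of all iterations uniformly Lipschitz.\<close>

lemma approx_dual_solution_bounded:
  assumes V: "convex_on X V" and l: "\<forall>x\<in>X. l \<le> V x" and z0: "z0 \<in> Z"
    and \<mu>: "approx_max d UNIV (dualf V z0) \<mu>"
    and K: "\<And>z. z \<in> enlarge (e/2) Z \<Longrightarrow> val V z \<le> ereal K"
  shows "norm \<mu> \<le> (K - m - l + d) * 2 / e"
proof (cases "\<mu> = 0")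
  case True
  have "z0 \<in> enlarge (e/2) Z" using subset_enlarge[of "e/2" Z] e_pos z0 by auto
  from order_trans[OF approx_dual_solution_subgradient[OF V l z0 \<mu>, of z0] K[OF this]]
  have "rval V z0 - d \<le> K" by simp
  moreover have "m + l \<le> rval V z0"
    using val_lower[OF z0 l] val_eq_rval[OF V l Z_enlarge[OF z0]] by simp
  ultimately show ?thesis using True e_pos by simp
next
  case False
  define z where "z = z0 + (e / 2 / norm \<mu>) *\<^sub>R \<mu>"
  have z: "z \<in> enlarge (e/2) Z" using z0 e_pos False
    by (auto simp: mem_enlarge_iff dist_norm z_def intro!: bexI[of _ z0])
  have "ereal (rval V z0 - d + \<mu> \<bullet> (z - z0)) \<le> ereal K"
    by (rule order_trans[OF approx_dual_solution_subgradient[OF V l z0 \<mu>] K[OF z]])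
  moreover have "\<mu> \<bullet> (z - z0) = e / 2 * norm \<mu>"
    using False by (simp add: z_def dot_square_norm power2_eq_square)
  moreover have "m + l \<le> rval V z0"
    using val_lower[OF z0 l] val_eq_rval[OF V l Z_enlarge[OF z0]] by simp
  ultimately have "e / 2 * norm \<mu> \<le> K - m - l + d" by simp
  then show ?thesis using e_pos by (simp add: field_simps)
qed

end

section \<open>Stage problems\<close>

lemma convex_on_affine:
  fixes b :: "'a::real_inner"
  assumes "convex S"
  shows "convex_on S (\<lambda>x. a + b \<bullet> x)"
  unfolding convex_on_def
proof (intro conjI assms ballI allI impI)
  fix x y and u v :: real
  assume "u + v = 1"
  then have "a + b \<bullet> (u *\<^sub>R x + v *\<^sub>R y) = (u + v) * a + b \<bullet> (u *\<^sub>R x + v *\<^sub>R y)" by simp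
  then show "a + b \<bullet> (u *\<^sub>R x + v *\<^sub>R y) \<le> u * (a + b \<bullet> x) + v * (a + b \<bullet> y)"
    by (simp add: algebra_simps)
qed

lemma convex_on_max_affine:
  fixes f :: "'a::real_inner \<Rightarrow> real"
  assumes "convex_on S f" and eq: "\<And>x. x \<in> S \<Longrightarrow> g x = max (f x) (a + b \<bullet> x)"
  shows "convex_on S g"
  unfolding convex_on_def
proof (intro conjI ballI allI impI)
  show S: "convex S" using assms(1) by (simp add: convex_on_def)
  fix x y and u v :: real
  assume x: "x \<in> S" and y: "y \<in> S" and u: "0 \<le> u" and v: "0 \<le> v" and uv: "u + v = 1"
  let ?z = "u *\<^sub>R x + v *\<^sub>R y"
  have "f ?z \<le> u * f x + v * f y" using assms(1) x y u v uv by (simp add: convex_on_def)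
  also have "\<dots> \<le> u * g x + v * g y" using eq x y u v by (intro add_mono mult_left_mono) auto
  finally have 1: "f ?z \<le> u * g x + v * g y" .
  have "a + b \<bullet> ?z = (u + v) * a + b \<bullet> ?z" using uv by simp
  also have "\<dots> = u * (a + b \<bullet> x) + v * (a + b \<bullet> y)" by (simp add: algebra_simps)
  also have "\<dots> \<le> u * g x + v * g y" using eq x y u v by (intro add_mono mult_left_mono) auto
  finally have 2: "a + b \<bullet> ?z \<le> u * g x + v * g y" .
  have "?z \<in> S" using convexD[OF S x y u v uv] .
  with 1 2 eq show "g ?z \<le> u * g x + v * g y" by simp
qed

lemma convex_on_weighted_sum:
  assumes "finite A" "convex S" "\<And>i. i \<in> A \<Longrightarrow> convex_on S (f i)" "\<And>i. i \<in> A \<Longrightarrow> 0 \<le> c i"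
  shows "convex_on S (\<lambda>x. \<Sum>i\<in>A. c i * f i x)"
  using assms
proof (induction A rule: finite_induct)
  case empty then show ?case by (simp add: convex_on_def)
next
  case (insert a A)
  then show ?case by (auto intro!: convex_on_add convex_on_cmul)
qed

lemma joint_feasible_convex:
  assumes "convex (state_set P t)"
    and "\<And>i. i \<in> {1..ineq_dim P} \<Longrightarrow> ereal_convex (\<lambda>(x, z). ineq P t i x z v)"
  shows "convex (joint_feasible P t v)"
proof (rule convexI)
  fix p q and u w :: real
  assume p: "p \<in> joint_feasible P t v" and q: "q \<in> joint_feasible P t v"
    and u: "0 \<le> u" "0 \<le> w" "u + w = 1"
  obtain x z x' z' where pq: "p = (x, z)" "q = (x', z')" by (metis prod.exhaust)
  let ?x = "u *\<^sub>R x + w *\<^sub>R x'" and ?z = "u *\<^sub>R z + w *\<^sub>R z'"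
  have "A_mat P t v *v ?x + B_mat P t v *v ?z
      = u *\<^sub>R (A_mat P t v *v x + B_mat P t v *v z) + w *\<^sub>R (A_mat P t v *v x' + B_mat P t v *v z')"
    by (simp add: matrix_vector_right_distrib matrix_vector_mult_scaleR scaleR_add_right)
  also have "\<dots> = (u + w) *\<^sub>R b_vec P t v"
    using p q unfolding pq joint_feasible_def by (simp add: scaleR_add_left)
  finally have 1: "A_mat P t v *v ?x + B_mat P t v *v ?z = b_vec P t v" using u by simp
  have 2: "ineq P t i ?x ?z v \<le> 0" if "i \<in> {1..ineq_dim P}" for i
    using convexD[OF convex_sublevel_ereal[OF assms(2)[OF that]], of "(x, z)" "(x', z')" u w]
      p q u that unfolding pq joint_feasible_def by auto
  have 3: "?x \<in> state_set P t"
    using convexD[OF assms(1), of x x' u w] p q u unfolding pq joint_feasible_def by auto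
  show "u *\<^sub>R p + w *\<^sub>R q \<in> joint_feasible P t v"
    using 1 2 3 unfolding pq joint_feasible_def by auto
qed

text \<open>A decision that is nearly optimal for the future cost \<open>V\<close> loses, when the future cost is \<open>W\<close>, at most
  the difference of the two future costs at that decision. This inequality carries the error from the
  children of a node to the node.\<close>

lemma stage_value_approx_min:
  assumes "approx_min d (feasible P t z v) (\<lambda>y. cost P t y z v + ereal (V y)) y"
  shows "stage_value P t (\<lambda>x. ereal (W x)) z v
      \<le> stage_value P t (\<lambda>x. ereal (V x)) z v + ereal (W y - V y + d)"
proof -
  have y: "y \<in> feasible P t z v"
    and le: "cost P t y z v + ereal (V y) \<le> stage_value P t (\<lambda>x. ereal (V x)) z v + ereal d"
    using assms by (auto simp: approx_min_def stage_value_def)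
  have "stage_value P t (\<lambda>x. ereal (W x)) z v \<le> cost P t y z v + ereal (W y)"
    unfolding stage_value_def by (rule INF_lower[OF y])
  also have "\<dots> = cost P t y z v + ereal (V y) + ereal (W y - V y)"
    by (cases "cost P t y z v") auto
  also have "\<dots> \<le> stage_value P t (\<lambda>x. ereal (V x)) z v + ereal d + ereal (W y - V y)"
    by (intro add_right_mono le)
  also have "\<dots> = stage_value P t (\<lambda>x. ereal (V x)) z v + ereal (W y - V y + d)"
    by (cases "stage_value P t (\<lambda>x. ereal (V x)) z v") auto
  finally show ?thesis .
qed

lemma feasible_subset: "feasible P t z v \<subseteq> state_set P t"
  by (auto simp: feasible_def joint_feasible_def)

lemma stage_value_mono:
  assumes "\<And>x. x \<in> state_set P t \<Longrightarrow> V x \<le> W x"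
  shows "stage_value P t V z v \<le> stage_value P t W z v"
  unfolding stage_value_def
proof (rule INF_mono)
  fix x assume "x \<in> feasible P t z v"
  then show "\<exists>y\<in>feasible P t z v. cost P t y z v + V y \<le> cost P t x z v + W x"
    using assms feasible_subset[of P t z v] by (intro bexI[of _ x] add_left_mono) auto
qed

lemma stage_value_cong:
  assumes "\<And>x. x \<in> state_set P t \<Longrightarrow> V x = W x"
  shows "stage_value P t V z v = stage_value P t W z v"
  by (intro antisym stage_value_mono) (simp_all add: assms)

section \<open>Cuts and cost-to-go functions\<close>

text \<open>The deterministic content of the hypotheses on the problem, with the radius \<open>e\<close> of the enlargements fixed
  and the law of the process reduced to its supports and weights.\<close>

locale convex_msp =
  fixes P :: "('n::finite, 'q::finite, 'K::finite) msp" and e :: real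
  assumes horizon_pos: "1 \<le> horizon P"
    and supp_finite: "t \<in> {1..horizon P} \<Longrightarrow> finite (supp P t)"
    and supp_first: "supp P 1 = {xi_first P}"
    and prb_pos: "t \<in> {1..horizon P} \<Longrightarrow> v \<in> supp P t \<Longrightarrow> 0 < prb P t v"
    and prb_sum: "t \<in> {1..horizon P} \<Longrightarrow> (\<Sum>v\<in>supp P t. prb P t v) = 1"
    and state_0: "state_set P 0 = {x_init P}"
    and e_pos: "0 < e"
    and state: "t \<in> {1..horizon P} \<Longrightarrow>
      state_set P t \<noteq> {} \<and> compact (state_set P t) \<and> convex (state_set P t)"
    and cost_convex: "t \<in> {1..horizon P} \<Longrightarrow> v \<in> supp P t \<Longrightarrow> ereal_convex (\<lambda>(x, z). cost P t x z v)"
    and cost_proper: "t \<in> {1..horizon P} \<Longrightarrow> v \<in> supp P t \<Longrightarrow> ereal_proper (\<lambda>(x, z). cost P t x z v)"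
    and cost_lsc: "t \<in> {1..horizon P} \<Longrightarrow> v \<in> supp P t \<Longrightarrow>
      lsc_on (state_set P t \<times> state_set P (t - 1)) (\<lambda>(x, z). cost P t x z v)"
    and cost_finite: "t \<in> {1..horizon P} \<Longrightarrow> v \<in> supp P t \<Longrightarrow> z \<in> enlarge e (state_set P (t - 1)) \<Longrightarrow>
      x \<in> state_set P t \<Longrightarrow> cost P t x z v < \<infinity>"
    and ineq_convex: "t \<in> {1..horizon P} \<Longrightarrow> v \<in> supp P t \<Longrightarrow> i \<in> {1..ineq_dim P} \<Longrightarrow>
      ereal_convex (\<lambda>(x, z). ineq P t i x z v)"
    and feasible_first: "feasible P 1 (x_init P) (xi_first P) \<noteq> {}"
    and feasible_later: "t \<in> {2..horizon P} \<Longrightarrow> v \<in> supp P t \<Longrightarrow> z \<in> enlarge e (state_set P (t - 1)) \<Longrightarrow>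
      feasible P t z v \<noteq> {}"
begin

abbreviation "T \<equiv> horizon P"
abbreviation "X \<equiv> state_set P"

lemma X_compact: "t \<le> T \<Longrightarrow> compact (X t)"
  using state[of t] state_0 by (cases "t = 0") auto

lemma X_convex: "t \<le> T \<Longrightarrow> convex (X t)"
  using state[of t] state_0 by (cases "t = 0") auto

lemma X_nonempty: "t \<le> T \<Longrightarrow> X t \<noteq> {}"
  using state[of t] state_0 by (cases "t = 0") auto

lemma cost_not_MInf: "t \<in> {1..T} \<Longrightarrow> v \<in> supp P t \<Longrightarrow> cost P t x z v \<noteq> -\<infinity>"
  using cost_proper[of t v] unfolding ereal_proper_def by auto

definition cost_lb :: "nat \<Rightarrow> real^'K \<Rightarrow> real" where
  "cost_lb t v = (SOME m. \<forall>x\<in>X t. \<forall>z\<in>X (t - 1). ereal m \<le> cost P t x z v)"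

lemma cost_lb:
  assumes "t \<in> {1..T}" "v \<in> supp P t" "x \<in> X t" "z \<in> X (t - 1)"
  shows "ereal (cost_lb t v) \<le> cost P t x z v"
proof -
  have "compact (X t \<times> X (t - 1))" using assms by (intro compact_Times X_compact) auto
  then have "\<exists>m::real. \<forall>p\<in>X t \<times> X (t - 1). ereal m \<le> (case p of (x, z) \<Rightarrow> cost P t x z v)"
    by (rule lsc_on_compact_bounded_below[OF _ cost_lsc]) (use assms cost_not_MInf in auto)
  then have "\<exists>m. \<forall>x\<in>X t. \<forall>z\<in>X (t - 1). ereal m \<le> cost P t x z v" by auto
  from someI_ex[OF this] show ?thesis using assms unfolding cost_lb_def by blast
qed

lemma parametric_stage:
  assumes t: "t \<in> {2..T}" and v: "v \<in> supp P t"
  shows "parametric_program (X t) (X (t - 1)) (joint_feasible P t v) (\<lambda>x z. cost P t x z v) e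
    (cost_lb t v)"
proof
  have t1: "t \<in> {1..T}" using t by simp
  show "0 < e" by (rule e_pos)
  show "X (t - 1) \<noteq> {}" "compact (X (t - 1))" "convex (X (t - 1))"
    using t X_nonempty X_compact X_convex by auto
  show "convex (joint_feasible P t v)"
    by (rule joint_feasible_convex) (use t1 v ineq_convex X_convex in auto)
  show "\<And>x z. (x, z) \<in> joint_feasible P t v \<Longrightarrow> x \<in> X t" by (simp add: joint_feasible_def)
  show "\<And>z. z \<in> enlarge e (X (t - 1)) \<Longrightarrow> \<exists>x. (x, z) \<in> joint_feasible P t v"
    using feasible_later[OF t v] by (auto simp: feasible_def)
  show "ereal_convex (\<lambda>(x, z). cost P t x z v)" by (rule cost_convex[OF t1 v])
  show "\<And>x z. cost P t x z v \<noteq> -\<infinity>" by (rule cost_not_MInf[OF t1 v])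
  show "\<And>x z. x \<in> X t \<Longrightarrow> z \<in> enlarge e (X (t - 1)) \<Longrightarrow> cost P t x z v < \<infinity>"
    using cost_finite[OF t1 v] by blast
  show "\<And>x z. x \<in> X t \<Longrightarrow> z \<in> X (t - 1) \<Longrightarrow> ereal (cost_lb t v) \<le> cost P t x z v"
    by (rule cost_lb[OF t1 v])
qed

text \<open>As shown below, these real numbers represent the extended-real stage values on the state sets whenever
  \<open>V\<close> is convex and bounded below on the state set of stage \<open>t\<close>.\<close>

definition sval :: "nat \<Rightarrow> (real^'n \<Rightarrow> real) \<Rightarrow> real^'n \<Rightarrow> real^'K \<Rightarrow> real" where
  "sval t V z v = real_of_ereal (stage_value P t (\<lambda>x. ereal (V x)) z v)"

definition esval :: "nat \<Rightarrow> (real^'n \<Rightarrow> real) \<Rightarrow> real^'n \<Rightarrow> real" where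
  "esval t V z = (\<Sum>v\<in>supp P t. prb P t v * sval t V z v)"

lemma program_val:
  assumes "t \<in> {2..T}" and "v \<in> supp P t"
  shows "parametric_program.val (joint_feasible P t v) (\<lambda>x z. cost P t x z v) V z
      = stage_value P t (\<lambda>x. ereal (V x)) z v"
    and "parametric_program.rval (joint_feasible P t v) (\<lambda>x z. cost P t x z v) V z = sval t V z v"
    and "parametric_program.dualf (joint_feasible P t v) (\<lambda>x z. cost P t x z v) V z
      = dual_function P t V z v"
proof -
  interpret S: parametric_program "X t" "X (t - 1)" "joint_feasible P t v" "\<lambda>x z. cost P t x z v"
    e "cost_lb t v" by (rule parametric_stage[OF assms])
  show 1: "S.val V z = stage_value P t (\<lambda>x. ereal (V x)) z v"
    by (simp add: S.val_def stage_value_def feasible_def)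
  show "S.rval V z = sval t V z v" by (simp add: S.rval_def sval_def 1)
  show "S.dualf V z = dual_function P t V z v"
    by (simp add: S.dualf_def dual_function_def fun_eq_iff)
qed

context
  fixes t v V l
  assumes t: "t \<in> {2..T}" and v: "v \<in> supp P t"
    and V: "convex_on (X t) V" and l: "\<forall>x\<in>X t. l \<le> V x"
begin

interpretation S: parametric_program "X t" "X (t - 1)" "joint_feasible P t v" "\<lambda>x z. cost P t x z v"
    e "cost_lb t v" by (rule parametric_stage[OF t v])

lemma stage_value_eq_sval:
  "z \<in> enlarge e (X (t - 1)) \<Longrightarrow> stage_value P t (\<lambda>x. ereal (V x)) z v = ereal (sval t V z v)"
  using S.val_eq_rval[OF V l] by (simp add: program_val[OF t v])

lemma convex_sval: "convex_on (X (t - 1)) (\<lambda>z. sval t V z v)"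
proof -
  have "S.rval V = (\<lambda>z. sval t V z v)" using program_val[OF t v] by (simp add: fun_eq_iff)
  then show ?thesis
    using convex_on_subset[OF S.convex_rval[OF V l] _ S.Z_convex] S.Z_enlarge by auto
qed

lemma continuous_sval: "continuous_on (X (t - 1)) (\<lambda>z. sval t V z v)"
  using continuous_on_subset[OF S.rval_continuous_bounded(1)[OF V l]] subset_enlarge[of "e/2" "X (t - 1)"]
    e_pos by (auto simp: program_val[OF t v])

lemma stage_value_upper_bound:
  "\<exists>K. \<forall>z\<in>enlarge (e/2) (X (t - 1)). stage_value P t (\<lambda>x. ereal (V x)) z v \<le> ereal K"
proof -
  obtain K where K: "\<forall>z\<in>enlarge (e/2) (X (t - 1)). S.rval V z \<le> K"
    using S.rval_continuous_bounded(2)[OF V l] by blast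
  have "enlarge (e/2) (X (t - 1)) \<subseteq> enlarge e (X (t - 1))"
    using e_pos by (intro enlarge_mono) simp
  with K show ?thesis
    by (intro exI[of _ K]) (auto simp: stage_value_eq_sval program_val[OF t v] subset_iff)
qed

lemma approx_dual:
  assumes z0: "z0 \<in> X (t - 1)" and \<mu>: "approx_max d UNIV (dual_function P t V z0 v) \<mu>"
  shows "z \<in> X (t - 1) \<Longrightarrow> sval t V z0 v - d + \<mu> \<bullet> (z - z0) \<le> sval t V z v"
    and "(\<And>z. z \<in> enlarge (e/2) (X (t - 1)) \<Longrightarrow> stage_value P t (\<lambda>x. ereal (V x)) z v \<le> ereal K) \<Longrightarrow>
      norm \<mu> \<le> (K - cost_lb t v - l + d) * 2 / e"
proof -
  have \<mu>': "approx_max d UNIV (S.dualf V z0) \<mu>" using \<mu> by (simp add: program_val[OF t v])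
  show "sval t V z0 v - d + \<mu> \<bullet> (z - z0) \<le> sval t V z v" if "z \<in> X (t - 1)"
    using S.approx_dual_solution_subgradient[OF V l z0 \<mu>', of z] stage_value_eq_sval[OF S.Z_enlarge[OF that]]
    by (simp add: program_val[OF t v])
  show "norm \<mu> \<le> (K - cost_lb t v - l + d) * 2 / e"
    if "\<And>z. z \<in> enlarge (e/2) (X (t - 1)) \<Longrightarrow> stage_value P t (\<lambda>x. ereal (V x)) z v \<le> ereal K"
    using S.approx_dual_solution_bounded[OF V l z0 \<mu>'] that by (simp add: program_val[OF t v])
qed

lemma approx_primal_value:
  assumes z0: "z0 \<in> X (t - 1)"
    and y: "approx_min d {(y, z). (y, z) \<in> joint_feasible P t v \<and> z = z0}
             (\<lambda>(y, z). cost P t y z v + ereal (V y)) (y, z0)"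
  shows "sval t V z0 v \<le> real_of_ereal (cost P t y z0 v) + V y"
    and "real_of_ereal (cost P t y z0 v) + V y \<le> sval t V z0 v + d"
proof -
  have y1: "y \<in> feasible P t z0 v" using y by (simp add: approx_min_def feasible_def)
  have *: "{(y, z). (y, z) \<in> joint_feasible P t v \<and> z = z0} = (\<lambda>y. (y, z0)) ` feasible P t z0 v"
    by (auto simp: feasible_def)
  have le: "cost P t y z0 v + ereal (V y) \<le> stage_value P t (\<lambda>x. ereal (V x)) z0 v + ereal d"
    using y unfolding approx_min_def * by (simp add: stage_value_def image_image)
  have ge: "stage_value P t (\<lambda>x. ereal (V x)) z0 v \<le> cost P t y z0 v + ereal (V y)"
    unfolding stage_value_def by (rule INF_lower[OF y1])
  have "cost P t y z0 v < \<infinity>"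
    using cost_finite[of t v z0 y] t v y1 feasible_subset S.Z_enlarge[OF z0] by fastforce
  moreover have "cost P t y z0 v \<noteq> -\<infinity>" using cost_not_MInf[of t v] t v by auto
  ultimately obtain q where q: "cost P t y z0 v = ereal q" by (cases "cost P t y z0 v") auto
  show "sval t V z0 v \<le> real_of_ereal (cost P t y z0 v) + V y"
    and "real_of_ereal (cost P t y z0 v) + V y \<le> sval t V z0 v + d"
    using le ge unfolding q stage_value_eq_sval[OF S.Z_enlarge[OF z0]] by auto
qed

end

lemma esval_mono:
  assumes t: "t \<in> {2..T}" and V: "convex_on (X t) V" "\<forall>x\<in>X t. l \<le> V x"
    and W: "convex_on (X t) W" "\<forall>x\<in>X t. V x \<le> W x" and z: "z \<in> X (t - 1)"
  shows "esval t V z \<le> esval t W z"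
  unfolding esval_def
proof (intro sum_mono mult_left_mono)
  fix v assume v: "v \<in> supp P t"
  have z': "z \<in> enlarge e (X (t - 1))" using subset_enlarge[of e "X (t - 1)"] e_pos z by auto
  have l': "\<forall>x\<in>X t. l \<le> W x" using V W by force
  have "stage_value P t (\<lambda>x. ereal (V x)) z v \<le> stage_value P t (\<lambda>x. ereal (W x)) z v"
    by (rule stage_value_mono) (use W in auto)
  then show "sval t V z v \<le> sval t W z v"
    using stage_value_eq_sval[OF t v V z'] stage_value_eq_sval[OF t v W(1) l' z'] by simp
  show "0 \<le> prb P t v" using prb_pos[of t v] t v by simp
qed

text \<open>The cut built from \<open>d\<close>-optimal primal and dual solutions at the trial point \<open>z0\<close>. Each realization
  contributes an overestimate by at most \<open>d\<close> from the primal value and by at most \<open>d\<close> from the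
  \<open>d\<close>-subgradient; lowering the cut by \<open>2 * d\<close> therefore makes it valid, at the price of an error
  \<open>2 * d\<close> at the trial point.\<close>

lemma cut_bounds:
  fixes t V
  assumes t: "t \<in> {2..T}" and V: "convex_on (X t) V" "\<forall>x\<in>X t. l \<le> V x"
    and z0: "z0 \<in> X (t - 1)"
    and xb: "\<And>v. v \<in> supp P t \<Longrightarrow> approx_min d {(y, z). (y, z) \<in> joint_feasible P t v \<and> z = z0}
             (\<lambda>(y, z). cost P t y z v + ereal (V y)) (xb v, z0)"
    and lam: "\<And>v. v \<in> supp P t \<Longrightarrow> approx_max d UNIV (dual_function P t V z0 v) (lam v)"
  defines "\<beta> \<equiv> \<Sum>v\<in>supp P t. prb P t v *\<^sub>R lam v"
  defines "\<theta> \<equiv> \<Sum>v\<in>supp P t. prb P t v * (real_of_ereal (cost P t (xb v) z0 v) + V (xb v) - lam v \<bullet> z0)"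
  shows "y \<in> X (t - 1) \<Longrightarrow> \<theta> - 2 * d + \<beta> \<bullet> y \<le> esval t V y"
    and "esval t V z0 - 2 * d \<le> \<theta> - 2 * d + \<beta> \<bullet> z0"
    and "(\<And>v z. v \<in> supp P t \<Longrightarrow> z \<in> enlarge (e/2) (X (t - 1)) \<Longrightarrow>
            stage_value P t (\<lambda>x. ereal (V x)) z v \<le> ereal (K v)) \<Longrightarrow>
      norm \<beta> \<le> (\<Sum>v\<in>supp P t. prb P t v * ((K v - cost_lb t v - l + d) * 2 / e))"
proof -
  have t1: "t \<in> {1..T}" using t by simp
  have pos: "0 \<le> prb P t v" if "v \<in> supp P t" for v using prb_pos[OF t1 that] by simp
  let ?c = "\<lambda>v. real_of_ereal (cost P t (xb v) z0 v) + V (xb v)"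
  have eq: "\<theta> - 2 * d + \<beta> \<bullet> y = (\<Sum>v\<in>supp P t. prb P t v * (?c v - 2 * d + lam v \<bullet> (y - z0)))" for y
  proof -
    have "(\<Sum>v\<in>supp P t. prb P t v * (?c v - 2 * d + lam v \<bullet> (y - z0)))
        = (\<Sum>v\<in>supp P t. prb P t v * (?c v - lam v \<bullet> z0) + prb P t v * (lam v \<bullet> y) - prb P t v * (2 * d))"
      by (intro sum.cong) (auto simp: algebra_simps)
    also have "\<dots> = \<theta> + \<beta> \<bullet> y - (\<Sum>v\<in>supp P t. prb P t v) * (2 * d)"
      by (simp add: sum.distrib sum_subtractf \<theta>_def \<beta>_def inner_sum_left sum_distrib_right)
    finally show ?thesis using prb_sum[OF t1] by simp
  qed
  show "\<theta> - 2 * d + \<beta> \<bullet> y \<le> esval t V y" if y: "y \<in> X (t - 1)"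
    unfolding eq esval_def
  proof (intro sum_mono mult_left_mono pos)
    fix v assume v: "v \<in> supp P t"
    show "?c v - 2 * d + lam v \<bullet> (y - z0) \<le> sval t V y v"
      using approx_dual(1)[OF t v V z0 lam[OF v] y] approx_primal_value(2)[OF t v V z0 xb[OF v]]
      by linarith
  qed
  have "esval t V z0 \<le> (\<Sum>v\<in>supp P t. prb P t v * ?c v)"
    unfolding esval_def by (intro sum_mono mult_left_mono pos approx_primal_value(1)[OF t _ V z0 xb])
  moreover have "(\<Sum>v\<in>supp P t. prb P t v * (?c v - 2 * d)) = (\<Sum>v\<in>supp P t. prb P t v * ?c v) - 2 * d"
    using prb_sum[OF t1] by (simp add: right_diff_distrib sum_subtractf flip: sum_distrib_right)
  ultimately show "esval t V z0 - 2 * d \<le> \<theta> - 2 * d + \<beta> \<bullet> z0" unfolding eq by simp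
  show "norm \<beta> \<le> (\<Sum>v\<in>supp P t. prb P t v * ((K v - cost_lb t v - l + d) * 2 / e))"
    if K: "\<And>v z. v \<in> supp P t \<Longrightarrow> z \<in> enlarge (e/2) (X (t - 1)) \<Longrightarrow>
            stage_value P t (\<lambda>x. ereal (V x)) z v \<le> ereal (K v)"
    unfolding \<beta>_def
  proof (rule order_trans[OF norm_sum], rule sum_mono)
    fix v assume v: "v \<in> supp P t"
    show "norm (prb P t v *\<^sub>R lam v) \<le> prb P t v * ((K v - cost_lb t v - l + d) * 2 / e)"
      using mult_left_mono[OF approx_dual(2)[OF t v V z0 lam[OF v] K[OF v]] pos[OF v]] pos[OF v] by simp
  qed
qed

definition ctg :: "nat \<Rightarrow> real^'n \<Rightarrow> real" where
  "ctg t z = real_of_ereal (cost_to_go P t z)"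

lemma cost_to_go_end: "cost_to_go P (Suc T) z = 0"
  by (simp add: cost_to_go_def)

lemma cost_to_go_rec:
  assumes "t \<in> {1..T}"
  shows "cost_to_go P t z
    = (\<Sum>v\<in>supp P t. ereal (prb P t v) * stage_value P t (cost_to_go P (Suc t)) z v)"
proof -
  have *: "T + 1 - t = Suc (T - t)" "T - (T - t) = t" using assms by auto
  show ?thesis unfolding cost_to_go_def *(1) cost_to_go_rem.simps *(2) by (simp add: diff_Suc_Suc)
qed

lemma continuous_bounded_below:
  fixes f :: "real^'n \<Rightarrow> real"
  assumes "t \<le> T" "continuous_on (X t) f"
  shows "\<exists>l. \<forall>x\<in>X t. l \<le> f x"
  using continuous_attains_inf[OF X_compact X_nonempty assms(2)] assms(1) by blast

text \<open>Backward induction: once the next cost-to-go function is convex and continuous on the compact state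
  set, it is bounded below there, and the results on parametric programs apply to the current stage.\<close>

lemma ctg_properties:
  assumes "t \<in> {2..Suc T}"
  shows "(\<forall>z\<in>X (t - 1). cost_to_go P t z = ereal (ctg t z))
    \<and> convex_on (X (t - 1)) (ctg t) \<and> continuous_on (X (t - 1)) (ctg t)
    \<and> (t \<le> T \<longrightarrow> (\<forall>z\<in>X (t - 1). ctg t z = esval t (ctg (Suc t)) z))"
proof -
  have "t \<le> Suc T" using assms by simp
  then show ?thesis using assms
  proof (induction t rule: inc_induct)
    case base
    have "ctg (Suc T) = (\<lambda>z. 0)" by (simp add: ctg_def cost_to_go_end fun_eq_iff)
    then show ?case using X_convex[of T] by (simp add: cost_to_go_end convex_on_def zero_ereal_def)
  next
    case (step t)
    then have t: "t \<in> {2..T}" and t1: "t \<in> {1..T}" and "Suc t \<in> {2..Suc T}" by auto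
    with step.IH have IH: "\<forall>z\<in>X t. cost_to_go P (Suc t) z = ereal (ctg (Suc t) z)"
      "convex_on (X t) (ctg (Suc t))" "continuous_on (X t) (ctg (Suc t))" by auto
    obtain l where l: "\<forall>x\<in>X t. l \<le> ctg (Suc t) x"
      using continuous_bounded_below[OF _ IH(3)] t by auto
    have eq: "cost_to_go P t z = ereal (esval t (ctg (Suc t)) z)" if z: "z \<in> X (t - 1)" for z
    proof -
      have z': "z \<in> enlarge e (X (t - 1))" using subset_enlarge[of e "X (t - 1)"] e_pos z by auto
      have "cost_to_go P t z = (\<Sum>v\<in>supp P t. ereal (prb P t v * sval t (ctg (Suc t)) z v))"
        unfolding cost_to_go_rec[OF t1]
      proof (rule sum.cong[OF refl])
        fix v assume v: "v \<in> supp P t"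
        have "stage_value P t (cost_to_go P (Suc t)) z v = stage_value P t (\<lambda>x. ereal (ctg (Suc t) x)) z v"
          by (rule stage_value_cong) (use IH in auto)
        also have "\<dots> = ereal (sval t (ctg (Suc t)) z v)"
          by (rule stage_value_eq_sval[OF t v IH(2) l z'])
        finally show "ereal (prb P t v) * stage_value P t (cost_to_go P (Suc t)) z v
            = ereal (prb P t v * sval t (ctg (Suc t)) z v)" by simp
      qed
      then show ?thesis by (simp add: esval_def)
    qed
    then have eq': "ctg t z = esval t (ctg (Suc t)) z" if "z \<in> X (t - 1)" for z
      using that by (simp add: ctg_def)
    have cv: "convex (X (t - 1))" using X_convex[of "t - 1"] t by auto
    have "convex_on (X (t - 1)) (esval t (ctg (Suc t)))"
      unfolding esval_def[abs_def]
      by (rule convex_on_weighted_sum[OF supp_finite[OF t1] cv convex_sval[OF t _ IH(2) l]])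
        (use prb_pos[OF t1] in \<open>auto intro: less_imp_le\<close>)
    then have "convex_on (X (t - 1)) (ctg t)"
      using eq' cv by (simp add: convex_on_def convexD)
    moreover have "continuous_on (X (t - 1)) (esval t (ctg (Suc t)))"
      unfolding esval_def[abs_def] by (intro continuous_intros continuous_sval[OF t _ IH(2) l])
    then have "continuous_on (X (t - 1)) (ctg t)"
      using continuous_on_cong[OF refl, of "X (t - 1)" "ctg t"] eq' by simp
    moreover have "cost_to_go P t z = ereal (ctg t z)" if "z \<in> X (t - 1)" for z
      using eq[OF that] eq'[OF that] by simp
    ultimately show ?case using eq' by blast
  qed
qed

end

section \<open>Convergence of the approximations on a sample path\<close>

text \<open>On a finite net convergence is uniform, and the common Lipschitz constant transports it to all points.\<close>

lemma uniform_limit_of_equilipschitz: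
  fixes f :: "nat \<Rightarrow> 'a::metric_space \<Rightarrow> real"
  assumes S: "compact S" and L: "0 \<le> L"
    and lip: "\<And>k x y. x \<in> S \<Longrightarrow> y \<in> S \<Longrightarrow> \<bar>f k x - f k y\<bar> \<le> L * dist x y"
    and lim: "\<And>x. x \<in> S \<Longrightarrow> (\<lambda>k. f k x) \<longlonglongrightarrow> g x"
  shows "continuous_on S g" and "uniform_limit S f g sequentially"
proof -
  have glip: "\<bar>g x - g y\<bar> \<le> L * dist x y" if "x \<in> S" "y \<in> S" for x y
    by (rule LIMSEQ_le_const2[OF tendsto_rabs[OF tendsto_diff[OF lim lim]]])
      (use that lip in auto)
  have "L-lipschitz_on S g"
    using glip L by (intro lipschitz_onI) (auto simp: dist_real_def)
  then show "continuous_on S g" by (rule lipschitz_on_continuous_on)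
  show "uniform_limit S f g sequentially"
    unfolding uniform_limit_iff
  proof (intro allI impI)
    fix r :: real assume r: "0 < r"
    define d where "d = r / (3 * (L + 1))"
    have d: "d > 0" "L * d \<le> r / 3" using r L by (auto simp: d_def field_simps)
    obtain C where C: "C \<subseteq> S" "finite C" "S \<subseteq> (\<Union>x\<in>C. ball x d)"
      by (rule compactE_image[OF S, of S "\<lambda>x. ball x d"]) (use d in auto)
    have "\<forall>\<^sub>F k in sequentially. \<forall>x\<in>C. dist (f k x) (g x) < r / 3"
    proof (intro eventually_ball_finite ballI)
      fix x assume "x \<in> C"
      then have "(\<lambda>k. f k x) \<longlonglongrightarrow> g x" using C lim by blast
      then show "\<forall>\<^sub>F k in sequentially. dist (f k x) (g x) < r / 3" by (rule tendstoD) (use r in simp)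
    qed (rule C(2))
    then show "\<forall>\<^sub>F k in sequentially. \<forall>x\<in>S. dist (f k x) (g x) < r"
    proof eventually_elim
      case (elim k)
      show ?case
      proof
        fix y assume y: "y \<in> S"
        then obtain x where x: "x \<in> C" "dist x y < d" using C by fastforce
        then have "L * dist x y \<le> r / 3" using d L
          by (meson less_imp_le mult_left_mono order_trans)
        moreover have "\<bar>f k x - f k y\<bar> \<le> L * dist x y" "\<bar>g x - g y\<bar> \<le> L * dist x y"
          using lip glip x y C by auto
        moreover have "\<bar>f k x - g x\<bar> < r / 3" using elim x by (simp add: dist_real_def)
        ultimately show "dist (f k y) (g y) < r" unfolding dist_real_def by linarith
      qed
    qed
  qed
qed

lemma abs_max_diff_le:
  fixes a b c d :: real
  assumes "\<bar>a - b\<bar> \<le> m" "\<bar>c - d\<bar> \<le> m"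
  shows "\<bar>max a c - max b d\<bar> \<le> m"
  using assms by linarith

lemma nodes_Suc:
  "n \<in> nodes P (Suc r) \<longleftrightarrow> (\<exists>m v. n = m @ [v] \<and> m \<in> nodes P r \<and> v \<in> supp P (Suc r))"
proof
  assume n: "n \<in> nodes P (Suc r)"
  then have "n \<noteq> []" by (auto simp: nodes_def)
  then have "n = butlast n @ [last n]" by simp
  moreover have "butlast n \<in> nodes P r" using n by (auto simp: nodes_def nth_butlast)
  moreover have "last n \<in> supp P (Suc r)" using n \<open>n \<noteq> []\<close>
    by (auto simp: nodes_def last_conv_nth)
  ultimately show "\<exists>m v. n = m @ [v] \<and> m \<in> nodes P r \<and> v \<in> supp P (Suc r)" by blast
qed (auto simp: nodes_def nth_append less_Suc_eq)

text \<open>One sample path of the algorithm. Up to the behaviour of the gaps at iterations that do not visit a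
  node, the convergence analysis is deterministic.\<close>

locale isddp_path = convex_msp P e for P :: "('n::finite, 'q::finite, 'K::finite) msp" and e +
  fixes \<delta> \<epsilon> :: "nat \<Rightarrow> nat \<Rightarrow> real"
    and Q0 :: "nat \<Rightarrow> real^'n \<Rightarrow> real"
    and s :: "nat \<Rightarrow> nat \<Rightarrow> real^'K"
    and xf :: "nat \<Rightarrow> nat \<Rightarrow> real^'n"
    and xb lam :: "nat \<Rightarrow> nat \<Rightarrow> real^'K \<Rightarrow> real^'n"
    and Q :: "nat \<Rightarrow> nat \<Rightarrow> real^'n \<Rightarrow> real"
  assumes eps_lim: "t \<in> {2..T} \<Longrightarrow> (\<lambda>k. \<epsilon> t k) \<longlonglongrightarrow> 0"
    and delta_lim: "t \<in> {1..T} \<Longrightarrow> (\<lambda>k. \<delta> t k) \<longlonglongrightarrow> 0"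
    and init: "isddp_init P Q0"
    and run: "isddp_run P \<delta> \<epsilon> Q0 s xf xb lam Q"
begin

lemma Q_end: "x \<in> X T \<Longrightarrow> Q k (Suc T) x = 0"
  using run unfolding isddp_run_def by simp

lemma Q_start: "t \<in> {2..Suc T} \<Longrightarrow> x \<in> X (t - 1) \<Longrightarrow> Q 0 t x = Q0 t x"
  using run unfolding isddp_run_def by simp

lemma forward: "1 \<le> k \<Longrightarrow> forward_pass P (\<lambda>t. \<delta> t k) (s k) (Q (k - 1)) (xf k)"
  and backward: "1 \<le> k \<Longrightarrow> backward_pass P (\<lambda>t. \<epsilon> t k) (xf k) (xb k) (lam k) (Q (k - 1)) (Q k)"
  using run unfolding isddp_run_def by simp_all

lemma trial_point: "1 \<le> k \<Longrightarrow> t \<in> {1..T} \<Longrightarrow> xf k t \<in> X t"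
  using forward[of k] feasible_subset[of P t "xf k (t - 1)" "s k t"]
  by (auto simp: forward_pass_def approx_min_def)

text \<open>Iteration \<open>k\<close> adds the cut \<open>intercept k t + slope k t \<bullet> y\<close> to the approximation of stage \<open>t\<close>; the
  correction \<open>- 2 * \<epsilon> t k\<close> is part of the intercept.\<close>

definition slope :: "nat \<Rightarrow> nat \<Rightarrow> real^'n" where
  "slope k t = (\<Sum>v\<in>supp P t. prb P t v *\<^sub>R lam k t v)"

definition intercept :: "nat \<Rightarrow> nat \<Rightarrow> real" where
  "intercept k t = (\<Sum>v\<in>supp P t. prb P t v *
     (real_of_ereal (cost P t (xb k t v) (xf k (t - 1)) v) + Q k (Suc t) (xb k t v)
        - lam k t v \<bullet> xf k (t - 1))) - 2 * \<epsilon> t k"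

lemma Q_update:
  assumes "1 \<le> k" "t \<in> {2..T}" "y \<in> X (t - 1)"
  shows "Q k t y = max (Q (k - 1) t y) (intercept k t + slope k t \<bullet> y)"
  using backward[OF assms(1)] assms(2,3) unfolding backward_pass_def intercept_def slope_def Let_def
  by simp

lemma Q_mono_step:
  assumes "t \<in> {2..Suc T}" "y \<in> X (t - 1)"
  shows "Q k t y \<le> Q (Suc k) t y"
  using Q_update[of "Suc k" t y] Q_end assms by (cases "t = Suc T") auto

lemma Q_mono:
  assumes "t \<in> {2..Suc T}" "y \<in> X (t - 1)" "k \<le> k'"
  shows "Q k t y \<le> Q k' t y"
  by (rule lift_Suc_mono_le[of "\<lambda>k. Q k t y", OF Q_mono_step[OF assms(1,2)] assms(3)])

lemma cut:
  assumes k: "1 \<le> k" and t: "t \<in> {2..T}"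
    and V: "convex_on (X t) (Q k (Suc t))" "\<forall>x\<in>X t. l \<le> Q k (Suc t) x"
  shows "y \<in> X (t - 1) \<Longrightarrow> intercept k t + slope k t \<bullet> y \<le> esval t (Q k (Suc t)) y"
    and "esval t (Q k (Suc t)) (xf k (t - 1)) - 2 * \<epsilon> t k \<le> intercept k t + slope k t \<bullet> xf k (t - 1)"
    and "(\<And>v z. v \<in> supp P t \<Longrightarrow> z \<in> enlarge (e/2) (X (t - 1)) \<Longrightarrow>
            stage_value P t (\<lambda>x. ereal (Q k (Suc t) x)) z v \<le> ereal (K v)) \<Longrightarrow>
      norm (slope k t) \<le> (\<Sum>v\<in>supp P t. prb P t v * ((K v - cost_lb t v - l + \<epsilon> t k) * 2 / e))"
proof -
  have "t - 1 \<in> {1..T}" using t by auto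
  then have z0: "xf k (t - 1) \<in> X (t - 1)" by (rule trial_point[OF k])
  have xb: "approx_min (\<epsilon> t k) {(y, z). (y, z) \<in> joint_feasible P t v \<and> z = xf k (t - 1)}
             (\<lambda>(y, z). cost P t y z v + ereal (Q k (Suc t) y)) (xb k t v, xf k (t - 1))"
    and lam: "approx_max (\<epsilon> t k) UNIV (dual_function P t (Q k (Suc t)) (xf k (t - 1)) v) (lam k t v)"
    if "v \<in> supp P t" for v
    using backward[OF k] t that unfolding backward_pass_def by auto
  note * = cut_bounds[OF t V z0 xb lam, folded slope_def, folded intercept_def]
  show "y \<in> X (t - 1) \<Longrightarrow> intercept k t + slope k t \<bullet> y \<le> esval t (Q k (Suc t)) y"
    using *(1) by blast
  show "esval t (Q k (Suc t)) (xf k (t - 1)) - 2 * \<epsilon> t k \<le> intercept k t + slope k t \<bullet> xf k (t - 1)"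
    using *(2) by blast
  show "norm (slope k t) \<le> (\<Sum>v\<in>supp P t. prb P t v * ((K v - cost_lb t v - l + \<epsilon> t k) * 2 / e))"
    if "\<And>v z. v \<in> supp P t \<Longrightarrow> z \<in> enlarge (e/2) (X (t - 1)) \<Longrightarrow>
            stage_value P t (\<lambda>x. ereal (Q k (Suc t) x)) z v \<le> ereal (K v)"
    using *(3)[of K] that by blast
qed

text \<open>What the approximations of stage \<open>t\<close> must satisfy for stage \<open>t - 1\<close> to inherit it. The bounds \<open>l\<close> and
  \<open>L\<close> do not depend on the iteration.\<close>

definition regular :: "nat \<Rightarrow> bool" where
  "regular t \<longleftrightarrow> (\<exists>l L. 0 \<le> L \<and> (\<forall>k. convex_on (X (t - 1)) (Q k t) \<and>
     (\<forall>x\<in>X (t - 1). l \<le> Q k t x \<and> Q k t x \<le> ctg t x) \<and>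
     (\<forall>x\<in>X (t - 1). \<forall>y\<in>X (t - 1). \<bar>Q k t x - Q k t y\<bar> \<le> L * dist x y)))"

text \<open>Cuts computed from minorants of the next cost-to-go function minorize the current one. Their slopes are
  bounded uniformly in \<open>k\<close>: on half of the enlargement the stage values lie below those of the true
  cost-to-go function, which are bounded, and the initial approximation bounds all later ones from below.\<close>

lemma regular_step:
  assumes t: "t \<in> {2..T}" and IH: "regular (Suc t)"
  shows "regular t"
proof -
  have t1: "t \<in> {1..T}" and t': "t \<in> {2..Suc T}" "Suc t \<in> {2..Suc T}" using t by auto
  have tT: "t - 1 \<le> T" "t \<le> T" using t by auto
  have Suc1: "Suc t - 1 = t" by simp
  obtain l' L' where V: "\<And>k. convex_on (X t) (Q k (Suc t))" "\<And>k. \<forall>x\<in>X t. l' \<le> Q k (Suc t) x"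
    and Vle: "\<And>k. \<forall>x\<in>X t. Q k (Suc t) x \<le> ctg (Suc t) x"
    using IH unfolding regular_def Suc1 by blast
  have C: "convex_on (X t) (ctg (Suc t))" and ctg: "\<forall>z\<in>X (t - 1). ctg t z = esval t (ctg (Suc t)) z"
    using ctg_properties[OF t'(2)] ctg_properties[OF t'(1)] t by auto
  have Cl: "\<forall>x\<in>X t. l' \<le> ctg (Suc t) x" using V(2)[of 0] Vle[of 0] by force
  obtain a b where ab: "\<forall>x\<in>X (t - 1). Q 0 t x = a + b \<bullet> x"
  proof -
    obtain a b where "\<forall>x\<in>X (t - 1). Q0 t x = a + b \<bullet> x"
      using init t'(1) unfolding isddp_init_def Suc_eq_plus1 by blast
    then show thesis using Q_start[OF t'(1)] by (intro that[of a b]) simp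
  qed
  have le0: "Q 0 t x \<le> ctg t x" if "x \<in> X (t - 1)" for x
  proof -
    have "ereal (Q0 t x) \<le> cost_to_go P t x"
      using init t'(1) that unfolding isddp_init_def Suc_eq_plus1 by blast
    also have "cost_to_go P t x = ereal (ctg t x)" using ctg_properties[OF t'(1)] that by blast
    finally show ?thesis using Q_start[OF t'(1) that] by simp
  qed
  have "continuous_on (X (t - 1)) (\<lambda>x. a + b \<bullet> x)" by (intro continuous_intros)
  then obtain l where l: "\<forall>x\<in>X (t - 1). l \<le> a + b \<bullet> x"
    using continuous_bounded_below[OF tT(1)] by blast
  have "\<exists>K. \<forall>z\<in>enlarge (e/2) (X (t - 1)). stage_value P t (\<lambda>x. ereal (ctg (Suc t) x)) z v \<le> ereal K"
    if "v \<in> supp P t" for v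
    by (rule stage_value_upper_bound[OF t that C Cl])
  then obtain K where K: "\<And>v z. v \<in> supp P t \<Longrightarrow> z \<in> enlarge (e/2) (X (t - 1)) \<Longrightarrow>
      stage_value P t (\<lambda>x. ereal (ctg (Suc t) x)) z v \<le> ereal (K v)" by metis
  have K': "stage_value P t (\<lambda>x. ereal (Q k (Suc t) x)) z v \<le> ereal (K v)"
    if "v \<in> supp P t" "z \<in> enlarge (e/2) (X (t - 1))" for v z k
    by (rule order_trans[OF stage_value_mono K[OF that]]) (use Vle in auto)
  obtain D where D: "\<And>k. \<epsilon> t k \<le> D"
    using convergent_imp_Bseq[OF convergentI[OF eps_lim[OF t]]]
    unfolding Bseq_def by (auto dest: abs_le_D1)
  \<comment> \<open>\<open>b\<close> is the slope of the initial approximation, the sum bounds the slopes of all cuts\<close>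
  define L where "L = max (norm b) (\<Sum>v\<in>supp P t. prb P t v * ((K v - cost_lb t v - l' + D) * 2 / e))"
  have L0: "0 \<le> L" by (simp add: L_def le_max_iff_disj)
  have slope: "norm (slope k t) \<le> L" if k: "1 \<le> k" for k
  proof -
    have "norm (slope k t) \<le> (\<Sum>v\<in>supp P t. prb P t v * ((K v - cost_lb t v - l' + \<epsilon> t k) * 2 / e))"
      by (rule cut(3)[OF k t V K'])
    also have "\<dots> \<le> (\<Sum>v\<in>supp P t. prb P t v * ((K v - cost_lb t v - l' + D) * 2 / e))"
      using e_pos D prb_pos[OF t1]
      by (intro sum_mono mult_left_mono divide_right_mono mult_right_mono) (auto intro: less_imp_le)
    finally show ?thesis by (simp add: L_def)
  qed
  have aff: "\<bar>(c + u \<bullet> x) - (c + u \<bullet> y)\<bar> \<le> L * dist x y" if "norm u \<le> L" for c and u x y :: "real^'n"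
    using Cauchy_Schwarz_ineq2[of u "x - y"] mult_right_mono[OF that norm_ge_zero[of "x - y"]]
    by (simp add: inner_diff_right dist_norm)
  have upd: "Q (Suc k) t y = max (Q k t y) (intercept (Suc k) t + slope (Suc k) t \<bullet> y)"
    if "y \<in> X (t - 1)" for k y using Q_update[of "Suc k" t y] t that by simp
  have "convex_on (X (t - 1)) (Q k t) \<and>
     (\<forall>x\<in>X (t - 1). l \<le> Q k t x \<and> Q k t x \<le> ctg t x) \<and>
     (\<forall>x\<in>X (t - 1). \<forall>y\<in>X (t - 1). \<bar>Q k t x - Q k t y\<bar> \<le> L * dist x y)" for k
  proof (induction k)
    case 0
    have "convex_on (X (t - 1)) (Q 0 t)"
      by (rule convex_on_max_affine[OF convex_on_affine[OF X_convex[OF tT(1)], of a b], of _ a b])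
        (use ab in simp)
    moreover have "norm b \<le> L" by (simp add: L_def)
    ultimately show ?case using ab l le0 aff by auto
  next
    case (Suc k)
    let ?a = "intercept (Suc k) t" and ?b = "slope (Suc k) t"
    have le: "?a + ?b \<bullet> y \<le> ctg t y" if y: "y \<in> X (t - 1)" for y
      using cut(1)[OF _ t V y, of "Suc k"] esval_mono[OF t V C Vle y, of "Suc k"] ctg y by simp
    have "convex_on (X (t - 1)) (Q (Suc k) t)"
      by (rule convex_on_max_affine[of _ "Q k t" _ ?a ?b]) (use Suc upd in auto)
    moreover have "l \<le> Q (Suc k) t x \<and> Q (Suc k) t x \<le> ctg t x" if "x \<in> X (t - 1)" for x
      using Suc upd[OF that] le[OF that] that by (auto simp: le_max_iff_disj)
    moreover have "\<bar>Q (Suc k) t x - Q (Suc k) t y\<bar> \<le> L * dist x y"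
      if "x \<in> X (t - 1)" "y \<in> X (t - 1)" for x y
    proof -
      have "\<bar>Q k t x - Q k t y\<bar> \<le> L * dist x y" using Suc that by blast
      moreover have "\<bar>(?a + ?b \<bullet> x) - (?a + ?b \<bullet> y)\<bar> \<le> L * dist x y"
        by (rule aff[OF slope]) simp
      ultimately show ?thesis unfolding upd[OF that(1)] upd[OF that(2)] by (rule abs_max_diff_le)
    qed
    ultimately show ?case by blast
  qed
  then show ?thesis unfolding regular_def using L0 by blast
qed

lemma regular: "t \<in> {2..Suc T} \<Longrightarrow> regular t"
proof -
  assume t: "t \<in> {2..Suc T}"
  then have "t \<le> Suc T" by simp
  then show ?thesis using t
  proof (induction t rule: inc_induct)
    case base
    have 0: "Q k (Suc T) x = 0" "ctg (Suc T) x = 0" if "x \<in> X T" for k x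
      using Q_end[OF that] by (simp_all add: ctg_def cost_to_go_end)
    have "convex_on (X T) (Q k (Suc T))" for k
      using X_convex[of T] 0(1) by (simp add: convex_on_def convexD)
    with 0 show ?case
      unfolding regular_def diff_Suc_1 by (intro exI[of _ 0]) simp
  next
    case (step t)
    have "t \<in> {2..T}" "Suc t \<in> {2..Suc T}" using step.hyps step.prems by auto
    then show ?case using regular_step step.IH by blast
  qed
qed

lemma Q_le_ctg: "t \<in> {2..Suc T} \<Longrightarrow> x \<in> X (t - 1) \<Longrightarrow> Q k t x \<le> ctg t x"
  using regular[of t] unfolding regular_def by blast

text \<open>The approximations increase with \<open>k\<close> and stay below \<open>ctg t\<close>, so the limit exists on the state set.\<close>

definition Qlim :: "nat \<Rightarrow> real^'n \<Rightarrow> real" where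
  "Qlim t x = lim (\<lambda>k. Q k t x)"

lemma Qlim:
  assumes t: "t \<in> {2..Suc T}"
  shows "continuous_on (X (t - 1)) (Qlim t)"
    and "uniform_limit (X (t - 1)) (\<lambda>k. Q k t) (Qlim t) sequentially"
proof -
  have tT: "t - 1 \<le> T" using t by auto
  obtain L where L: "0 \<le> L"
    "\<And>k x y. x \<in> X (t - 1) \<Longrightarrow> y \<in> X (t - 1) \<Longrightarrow> \<bar>Q k t x - Q k t y\<bar> \<le> L * dist x y"
    using regular[OF t] unfolding regular_def by blast
  have "(\<lambda>k. Q k t x) \<longlonglongrightarrow> Qlim t x" if "x \<in> X (t - 1)" for x
  proof -
    have "incseq (\<lambda>k. Q k t x)" using Q_mono[OF t that] by (simp add: incseq_def)
    then have "convergent (\<lambda>k. Q k t x)"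
      using incseq_convergent[of "\<lambda>k. Q k t x" "ctg t x"] Q_le_ctg[OF t that]
      by (metis convergentI)
    then show ?thesis by (simp add: Qlim_def convergent_LIMSEQ_iff)
  qed
  from uniform_limit_of_equilipschitz[OF X_compact[OF tT] L this]
  show "continuous_on (X (t - 1)) (Qlim t)"
    and "uniform_limit (X (t - 1)) (\<lambda>k. Q k t) (Qlim t) sequentially" by simp_all
qed

text \<open>A uniformly convergent sequence has uniformly vanishing increments. At a node it therefore does not
  matter in the limit whether the approximation is taken before or after the backward pass.\<close>

lemma Q_increment_small:
  assumes t: "t \<in> {2..Suc T}" and "0 < r"
  shows "\<forall>\<^sub>F k in sequentially. \<forall>x\<in>X (t - 1). \<bar>Q k t x - Q (k - 1) t x\<bar> < r"
proof -
  have "\<forall>\<^sub>F k in sequentially. \<forall>x\<in>X (t - 1). dist (Q k t x) (Qlim t x) < r / 2"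
    by (rule uniform_limitD[OF Qlim(2)[OF t]]) (use \<open>0 < r\<close> in simp)
  then obtain N where N: "\<And>k x. N \<le> k \<Longrightarrow> x \<in> X (t - 1) \<Longrightarrow> dist (Q k t x) (Qlim t x) < r / 2"
    unfolding eventually_sequentially by blast
  show ?thesis unfolding eventually_sequentially
  proof (intro exI allI impI ballI)
    fix k x assume k: "Suc N \<le> k" and x: "x \<in> X (t - 1)"
    have "dist (Q k t x) (Qlim t x) < r / 2" "dist (Q (k - 1) t x) (Qlim t x) < r / 2"
      using N[OF _ x, of k] N[OF _ x, of "k - 1"] k by auto
    then show "\<bar>Q k t x - Q (k - 1) t x\<bar> < r"
      unfolding dist_real_def by linarith
  qed
qed

end

section \<open>Gaps at the nodes of the scenario tree\<close>

locale isddp_simulation = isddp_path P e \<delta> \<epsilon> Q0 s xf xb lam Q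
  for P :: "('n::finite, 'q::finite, 'K::finite) msp" and e \<delta> \<epsilon> Q0 s xf xb lam Q +
  fixes xn :: "nat \<Rightarrow> (real^'K) list \<Rightarrow> real^'n"
  assumes sim: "simulation P \<delta> Q xn"
    and coupled: "coupled P s xf xn"
begin

lemma node_decision:
  assumes "1 \<le> k" "t \<in> {1..T}" "n \<in> nodes P (t - 1)" "v \<in> supp P t"
  shows "approx_min (\<delta> t k) (feasible P t (xn k n) v)
          (\<lambda>y. cost P t y (xn k n) v + ereal (Q (k - 1) (Suc t) y)) (xn k (n @ [v]))"
  using sim assms unfolding simulation_def by simp

lemma node_decision_mem:
  assumes "1 \<le> k" "t \<in> {1..T}" "n \<in> nodes P t"
  shows "xn k n \<in> X t"
proof -
  obtain m v where "n = m @ [v]" "m \<in> nodes P (t - 1)" "v \<in> supp P t"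
    using nodes_Suc[of n P "t - 1"] assms by auto
  with node_decision[OF assms(1,2), of m v] feasible_subset[of P t "xn k m" v] show ?thesis
    by (auto simp: approx_min_def)
qed

text \<open>The error at node \<open>n\<close> of the approximation that is in force when the decision \<open>xn k n\<close> is taken. The
  index \<open>k - 1\<close> makes it a function of the samples before iteration \<open>k\<close>.\<close>

definition gap :: "nat \<Rightarrow> (real^'K) list \<Rightarrow> nat \<Rightarrow> real" where
  "gap t n k = ctg t (xn k n) - Q (k - 1) t (xn k n)"

lemma gap_nonneg:
  assumes "t \<in> {2..Suc T}" "n \<in> nodes P (t - 1)" "1 \<le> k"
  shows "0 \<le> gap t n k"
proof -
  have "t - 1 \<in> {1..T}" using assms(1) by auto
  from Q_le_ctg[OF assms(1) node_decision_mem[OF assms(3) this assms(2)]]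
  show ?thesis by (simp add: gap_def)
qed

text \<open>If the sampled scenario passes through \<open>n\<close>, a cut is computed at \<open>xn k n\<close>. It is tight, up to \<open>2 * \<epsilon> t k\<close>,
  for the expected stage value with the current approximation of the next stage, and that approximation
  errs at the decisions of the children by their gaps.\<close>

lemma visited_node_gap:
  assumes t: "t \<in> {2..T}" and n: "n \<in> nodes P (t - 1)" and k: "1 \<le> k"
    and pass: "passes_through (s k) n"
  shows "ctg t (xn k n) - Q k t (xn k n)
    \<le> (\<Sum>v\<in>supp P t. prb P t v * (gap (Suc t) (n @ [v]) k + \<delta> t k)) + 2 * \<epsilon> t k"
proof -
  define z where "z = xn k n"
  have t1: "t \<in> {1..T}" and t': "t \<in> {2..Suc T}" "Suc t \<in> {2..Suc T}" using t by auto
  have xf: "xf k (t - 1) = z"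
    using coupled k n pass t unfolding coupled_def z_def by auto
  have "t - 1 \<in> {1..T}" using t by auto
  then have z: "z \<in> X (t - 1)" unfolding z_def by (rule node_decision_mem[OF k _ n])
  then have z': "z \<in> enlarge e (X (t - 1))" using subset_enlarge[of e "X (t - 1)"] e_pos by auto
  obtain l where V: "\<And>k. convex_on (X t) (Q k (Suc t))" "\<And>k. \<forall>x\<in>X t. l \<le> Q k (Suc t) x"
    using regular[OF t'(2)] unfolding regular_def diff_Suc_1 by blast
  have C: "convex_on (X t) (ctg (Suc t))" and ctg: "ctg t z = esval t (ctg (Suc t)) z"
    using ctg_properties[OF t'(2)] ctg_properties[OF t'(1)] t z by auto
  have Cl: "\<forall>x\<in>X t. l \<le> ctg (Suc t) x"
    using V(2)[of 0] Q_le_ctg[OF t'(2)] by (metis diff_Suc_1 order_trans)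
  have sv: "sval t (ctg (Suc t)) z v \<le> sval t (Q (k - 1) (Suc t)) z v + (gap (Suc t) (n @ [v]) k + \<delta> t k)"
    if v: "v \<in> supp P t" for v
    using stage_value_approx_min[OF node_decision[OF k t1 n v], of "ctg (Suc t)"]
      stage_value_eq_sval[OF t v C Cl z'] stage_value_eq_sval[OF t v V z', of "k - 1"]
    by (simp add: z_def gap_def)
  have "ctg t z \<le> (\<Sum>v\<in>supp P t. prb P t v *
      (sval t (Q (k - 1) (Suc t)) z v + (gap (Suc t) (n @ [v]) k + \<delta> t k)))"
    unfolding ctg esval_def using prb_pos[OF t1] by (intro sum_mono mult_left_mono sv) (auto intro: less_imp_le)
  also have "\<dots> = esval t (Q (k - 1) (Suc t)) z
      + (\<Sum>v\<in>supp P t. prb P t v * (gap (Suc t) (n @ [v]) k + \<delta> t k))"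
    by (simp add: esval_def distrib_left sum.distrib)
  finally have "ctg t z \<le> esval t (Q (k - 1) (Suc t)) z
      + (\<Sum>v\<in>supp P t. prb P t v * (gap (Suc t) (n @ [v]) k + \<delta> t k))" .
  moreover have "esval t (Q (k - 1) (Suc t)) z \<le> esval t (Q k (Suc t)) z"
    by (rule esval_mono[OF t V V(1) _ z]) (use Q_mono[OF t'(2)] in auto)
  moreover have "esval t (Q k (Suc t)) z - 2 * \<epsilon> t k \<le> Q k t z"
    using cut(2)[OF k t V] Q_update[OF k t z] xf by simp
  ultimately show ?thesis unfolding z_def by linarith
qed

text \<open>Backward induction on the stage. At the iterations that visit \<open>n\<close> the gap tends to \<open>0\<close> by the previous
  lemma. The premise, which holds for almost every sample path, excludes a gap that stays large on the
  remaining iterations: a gap that is large infinitely often is large infinitely often at visits.\<close>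

lemma gap_tendsto_0:
  assumes io: "\<And>t n j. t \<in> {2..T} \<Longrightarrow> n \<in> nodes P (t - 1) \<Longrightarrow>
      \<exists>\<^sub>F k in sequentially. inverse (real (Suc j)) < gap t n k \<Longrightarrow>
      \<exists>\<^sub>F k in sequentially. inverse (real (Suc j)) < gap t n k \<and> passes_through (s k) n"
    and t: "t \<in> {2..Suc T}" and n: "n \<in> nodes P (t - 1)"
  shows "gap t n \<longlonglongrightarrow> 0"
proof -
  have "t \<le> Suc T" using t by simp
  then show ?thesis using t n
  proof (induction t arbitrary: n rule: inc_induct)
    case base
    have "gap (Suc T) n k = 0" if "1 \<le> k" for k
      using Q_end node_decision_mem[OF that, of T n] base horizon_pos
      by (simp add: gap_def ctg_def cost_to_go_end)
    then have "\<forall>\<^sub>F k in sequentially. gap (Suc T) n k = 0"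
      by (auto simp: eventually_sequentially)
    then show ?case by (rule tendsto_eventually)
  next
    case (step t)
    then have t: "t \<in> {2..T}" and t1: "t \<in> {1..T}" and t': "t \<in> {2..Suc T}" by auto
    define err where "err k = (\<Sum>v\<in>supp P t. prb P t v * (gap (Suc t) (n @ [v]) k + \<delta> t k)) + 2 * \<epsilon> t k" for k
    have "gap (Suc t) (n @ [v]) \<longlonglongrightarrow> 0" if "v \<in> supp P t" for v
      by (rule step.IH) (use t step.prems that nodes_Suc[of "n @ [v]" P "t - 1"] in auto)
    then have "err \<longlonglongrightarrow> (\<Sum>v\<in>supp P t. prb P t v * (0 + 0)) + 2 * 0"
      unfolding err_def by (intro tendsto_intros delta_lim[OF t1] eps_lim[OF t])
    then have err: "err \<longlonglongrightarrow> 0" by simp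
    show ?case
    proof (rule LIMSEQ_I)
      fix r :: real assume "0 < r"
      then obtain j where j: "inverse (real (Suc j)) < r" using reals_Archimedean by blast
      let ?r = "inverse (real (Suc j))"
      have r2: "0 < ?r / 2" by simp
      have "\<forall>\<^sub>F k in sequentially. passes_through (s k) n \<longrightarrow> gap t n k \<le> ?r"
        using order_tendstoD(2)[OF err r2] Q_increment_small[OF t' r2] eventually_ge_at_top[of 1]
      proof eventually_elim
        case (elim k)
        show ?case
        proof
          assume "passes_through (s k) n"
          from visited_node_gap[OF t step.prems(2) _ this] elim
          have "ctg t (xn k n) - Q k t (xn k n) \<le> err k" by (simp add: err_def)
          moreover have "t - 1 \<in> {1..T}" using t by auto
          then have "xn k n \<in> X (t - 1)"
            using node_decision_mem[of k "t - 1" n] elim step.prems by blast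
          then have "\<bar>Q k t (xn k n) - Q (k - 1) t (xn k n)\<bar> < ?r / 2" using elim by blast
          ultimately show "gap t n k \<le> ?r" using elim unfolding gap_def by linarith
        qed
      qed
      then have "\<not> (\<exists>\<^sub>F k in sequentially. ?r < gap t n k \<and> passes_through (s k) n)"
        unfolding not_frequently by eventually_elim auto
      then have "\<forall>\<^sub>F k in sequentially. \<not> ?r < gap t n k"
        using io[OF t step.prems(2)] unfolding not_frequently[symmetric] by blast
      then have "\<forall>\<^sub>F k in sequentially. norm (gap t n k - 0) < r"
        using eventually_ge_at_top[of 1]
        by eventually_elim (use gap_nonneg[OF t' step.prems(2)] j in fastforce)
      then show "\<exists>N. \<forall>k\<ge>N. norm (gap t n k - 0) < r" by (simp add: eventually_sequentially)
    qed
  qed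
qed

text \<open>The approximation minorizes the cost-to-go function, so the approximate optimal values stay below the
  true one; the only node of stage 1 bounds the difference by its gap and the error level.\<close>

lemma first_stage_limit:
  assumes gap: "gap 2 [xi_first P] \<longlonglongrightarrow> 0"
  shows "(\<lambda>k. stage_value P 1 (\<lambda>x. ereal (Q (k - 1) 2 x)) (x_init P) (xi_first P)) \<longlonglongrightarrow> optimal_value P"
proof -
  let ?n = "[xi_first P]"
  let ?sv = "\<lambda>V. stage_value P 1 (\<lambda>x. ereal (V x)) (x_init P) (xi_first P)"
  have one: "1 \<in> {1..T}" and two: "(2::nat) \<in> {2..Suc T}" and v: "xi_first P \<in> supp P 1"
    using horizon_pos supp_first by auto
  have opt: "optimal_value P = ?sv (ctg 2)"
    unfolding optimal_value_def using ctg_properties[OF two] by (intro stage_value_cong) simp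
  have lb: "\<exists>l. \<forall>x\<in>X 1. l \<le> ctg 2 x"
    using ctg_properties[OF two] horizon_pos by (intro continuous_bounded_below) auto
  then obtain l where l: "\<And>x. x \<in> X 1 \<Longrightarrow> l \<le> ctg 2 x" by blast
  have "ereal (cost_lb 1 (xi_first P) + l) \<le> ?sv (ctg 2)"
    unfolding stage_value_def
  proof (rule INF_greatest)
    fix x assume "x \<in> feasible P 1 (x_init P) (xi_first P)"
    then have x: "x \<in> X 1" using feasible_subset by blast
    have "ereal (cost_lb 1 (xi_first P)) \<le> cost P 1 x (x_init P) (xi_first P)"
      by (rule cost_lb[OF one v x]) (simp add: state_0)
    then show "ereal (cost_lb 1 (xi_first P) + l) \<le> cost P 1 x (x_init P) (xi_first P) + ereal (ctg 2 x)"
      using l[OF x] by (metis add_mono ereal_less_eq(3) plus_ereal.simps(1))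
  qed
  moreover have "?sv (ctg 2) < \<infinity>"
  proof -
    obtain x where x: "x \<in> feasible P 1 (x_init P) (xi_first P)" using feasible_first by blast
    have "x_init P \<in> enlarge e (X (1 - 1))"
      using subset_enlarge[of e "X 0"] e_pos by (auto simp: state_0)
    then have "cost P 1 x (x_init P) (xi_first P) < \<infinity>"
      using cost_finite[OF one v] x feasible_subset by blast
    moreover have "?sv (ctg 2) \<le> cost P 1 x (x_init P) (xi_first P) + ereal (ctg 2 x)"
      unfolding stage_value_def by (rule INF_lower[OF x])
    ultimately show ?thesis by (cases "cost P 1 x (x_init P) (xi_first P)") auto
  qed
  ultimately obtain q where q: "?sv (ctg 2) = ereal q" by (cases "?sv (ctg 2)") auto
  have upper: "?sv (Q (k - 1) 2) \<le> ereal q" for k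
    unfolding q[symmetric] using Q_le_ctg[OF two] by (intro stage_value_mono) simp
  have lower: "ereal (q - (gap 2 ?n k + \<delta> 1 k)) \<le> ?sv (Q (k - 1) 2)" if k: "1 \<le> k" for k
  proof -
    have r: "[] \<in> nodes P (1 - 1)" by (simp add: nodes_def)
    have x0: "xn k [] = x_init P" using sim k unfolding simulation_def by simp
    have "ereal q \<le> ?sv (Q (k - 1) 2) + ereal (gap 2 ?n k + \<delta> 1 k)"
      using stage_value_approx_min[OF node_decision[OF k one r v], of "ctg 2"] q
      by (simp add: x0 gap_def numeral_2_eq_2)
    then show ?thesis by (cases "?sv (Q (k - 1) 2)") auto
  qed
  have lim: "(\<lambda>k. ereal (q - (gap 2 ?n k + \<delta> 1 k))) \<longlonglongrightarrow> ereal (q - (0 + 0))"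
    by (intro tendsto_intros tendsto_ereal gap delta_lim[OF one])
  then have lim': "(\<lambda>k. ereal (q - (gap 2 ?n k + \<delta> 1 k))) \<longlonglongrightarrow> ereal q" by simp
  show ?thesis unfolding opt q
    by (rule tendsto_sandwich[OF _ _ lim' tendsto_const])
      (use upper lower in \<open>unfold eventually_sequentially, blast+\<close>)
qed

text \<open>Along the subsequence, uniform convergence and continuity identify the limit of the approximations with
  \<open>Qlim t x\<close> and that of the cost-to-go function with its value at \<open>x\<close>, and the gap tends to \<open>0\<close>.\<close>

lemma Qlim_at_accumulation_point:
  assumes t: "t \<in> {2..T}" and n: "n \<in> nodes P (t - 1)" and gap: "gap t n \<longlonglongrightarrow> 0"
    and acc: "accumulation_point (\<lambda>k. xn k n) x"
  shows "ereal (Qlim t x) = cost_to_go P t x"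
proof -
  have t': "t \<in> {2..Suc T}" and t1: "t - 1 \<in> {1..T}" and tT: "t - 1 \<le> T" using t by auto
  obtain r :: "nat \<Rightarrow> nat" where r: "strict_mono r" and x: "(\<lambda>i. xn (r i) n) \<longlonglongrightarrow> x"
    using acc unfolding accumulation_point_def comp_def by blast
  have "\<forall>\<^sub>F i in sequentially. 1 \<le> r i"
    using strict_mono_imp_increasing[OF r] seq_suble[OF r] eventually_ge_at_top[of 1]
    by (metis (mono_tags, lifting) eventually_mono order_trans)
  then have mem: "\<forall>\<^sub>F i in sequentially. xn (r i) n \<in> X (t - 1)"
    by eventually_elim (use node_decision_mem[OF _ t1 n] in auto)
  have xX: "x \<in> X (t - 1)"
    by (rule Lim_in_closed_set[OF compact_imp_closed[OF X_compact[OF tT]] mem _ x]) simp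
  have 1: "(\<lambda>i. ctg t (xn (r i) n)) \<longlonglongrightarrow> ctg t x"
    using ctg_properties[OF t'] continuous_on_tendsto_compose[OF _ x xX mem] by blast
  have 2: "(\<lambda>i. Qlim t (xn (r i) n)) \<longlonglongrightarrow> Qlim t x"
    by (rule continuous_on_tendsto_compose[OF Qlim(1)[OF t'] x xX mem])
  have "filterlim (\<lambda>i. r i - 1) sequentially sequentially"
    using filterlim_compose[OF filterlim_minus_const_nat_at_top filterlim_subseq[OF r]] .
  then have "uniform_limit (X (t - 1)) (\<lambda>i. Q (r i - 1) t) (Qlim t) sequentially"
    using filterlim_compose[OF Qlim(2)[OF t']] by blast
  then have 3: "(\<lambda>i. Q (r i - 1) t (xn (r i) n) - Qlim t (xn (r i) n)) \<longlonglongrightarrow> 0"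
    unfolding uniform_limit_iff tendsto_iff
  proof (intro allI impI)
    fix d :: real assume u: "\<forall>e>0. \<forall>\<^sub>F i in sequentially. \<forall>x\<in>X (t - 1). dist (Q (r i - 1) t x) (Qlim t x) < e"
      and "0 < d"
    then have "\<forall>\<^sub>F i in sequentially. \<forall>x\<in>X (t - 1). dist (Q (r i - 1) t x) (Qlim t x) < d" by blast
    with mem show "\<forall>\<^sub>F i in sequentially. dist (Q (r i - 1) t (xn (r i) n) - Qlim t (xn (r i) n)) 0 < d"
      by eventually_elim (simp add: dist_real_def)
  qed
  have "(\<lambda>i. gap t n (r i)) \<longlonglongrightarrow> 0"
    using LIMSEQ_subseq_LIMSEQ[OF gap r] by (simp add: comp_def)
  from tendsto_diff[OF 1 tendsto_add[OF this tendsto_add[OF 3 2]]]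
  have "(\<lambda>i::nat. 0) \<longlonglongrightarrow> ctg t x - (0 + (0 + Qlim t x))" by (simp add: gap_def)
  then have "ctg t x = Qlim t x" using LIMSEQ_unique[OF _ tendsto_const] by fastforce
  then show ?thesis using ctg_properties[OF t'] xX by simp
qed

end

section \<open>Predictable selection of independent trials\<close>

context prob_space
begin

lemma indep_var_nn_integral_mult:
  fixes f g :: "'a \<Rightarrow> ennreal"
  assumes "indep_var borel f borel g"
  shows "(\<integral>\<^sup>+\<omega>. f \<omega> * g \<omega> \<partial>M) = (\<integral>\<^sup>+\<omega>. f \<omega> \<partial>M) * (\<integral>\<^sup>+\<omega>. g \<omega> \<partial>M)"
proof -
  have "case_bool borel borel = (\<lambda>_. borel :: ennreal measure)" by (auto split: bool.split)
  then have "indep_vars (\<lambda>_. borel) (case_bool f g) UNIV"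
    using assms unfolding indep_var_def by simp
  from indep_vars_nn_integral[OF _ this] show ?thesis
    by (simp add: UNIV_bool mult.commute)
qed

lemma indep_past_present:
  assumes "indep_vars (\<lambda>_. N) Y {1::nat..}" and k: "1 \<le> k"
    and g: "g \<in> borel_measurable (Pi\<^sub>M {1..<k} (\<lambda>_. N))" and h: "h \<in> borel_measurable N"
  shows "indep_var borel (\<lambda>\<omega>. g (\<lambda>i\<in>{1..<k}. Y i \<omega>)) borel (\<lambda>\<omega>. h (Y k \<omega>))"
proof -
  have "indep_var (Pi\<^sub>M {1..<k} (\<lambda>_. N)) (\<lambda>\<omega>. \<lambda>i\<in>{1..<k}. Y i \<omega>)
      (Pi\<^sub>M {k} (\<lambda>_. N)) (\<lambda>\<omega>. \<lambda>i\<in>{k}. Y i \<omega>)"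
    by (rule indep_var_restrict[OF assms(1)]) (use k in auto)
  moreover have "(\<lambda>x. h (x k)) \<in> borel_measurable (Pi\<^sub>M {k} (\<lambda>_. N))"
    by (rule measurable_compose[OF _ h]) (simp add: measurable_component_singleton)
  ultimately have "indep_var borel (g \<circ> (\<lambda>\<omega>. \<lambda>i\<in>{1..<k}. Y i \<omega>))
      borel ((\<lambda>x. h (x k)) \<circ> (\<lambda>\<omega>. \<lambda>i\<in>{k}. Y i \<omega>))"
    using g by (intro indep_var_compose)
  then show ?thesis by (simp add: comp_def)
qed

text \<open>Betting against the visits: the weight \<open>W K\<close> is multiplied by \<open>c\<close> whenever the past lies in
  \<open>S\<close> and \<open>Y\<close> misses \<open>B\<close>, and drops to \<open>0\<close> when the past lies in \<open>S\<close> and \<open>Y\<close> hits \<open>B\<close>. Since \<open>c\<close> times the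
  probability of a miss is at most 1, the weights form a nonnegative supermartingale, and by Fatou's
  lemma their lower limit is almost surely finite.\<close>

lemma avoidance_weights_finite:
  fixes Y :: "nat \<Rightarrow> 'a \<Rightarrow> 'b" and c :: real
  assumes indep: "indep_vars (\<lambda>_. N) Y {1..}"
    and S: "\<And>k. S k \<in> sets (Pi\<^sub>M {1..<k} (\<lambda>_. N))" and B: "B \<in> sets N"
    and c: "0 < c" "\<And>k. 1 \<le> k \<Longrightarrow> c * prob {\<omega> \<in> space M. Y k \<omega> \<notin> B} \<le> 1" and m: "1 \<le> m"
  defines "W \<equiv> \<lambda>K \<omega>. \<Prod>k\<in>{m..<K}. if (\<lambda>i\<in>{1..<k}. Y i \<omega>) \<in> S k then (if Y k \<omega> \<in> B then 0 else ennreal c) else 1"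
  shows "AE \<omega> in M. liminf (\<lambda>K. W K \<omega>) \<noteq> \<top>"
proof -
  have Y: "Y k \<in> measurable M N" if "1 \<le> k" for k using indep that unfolding indep_vars_def by simp
  \<comment> \<open>\<open>W K\<close> as a function of the past alone, to which independence of the present applies\<close>
  define g where "g K x = (\<Prod>k\<in>{m..<K}. if restrict x {1..<k} \<in> S k then (if x k \<in> B then 0 else ennreal c) else 1)"
    for K and x :: "nat \<Rightarrow> 'b"
  have g[measurable]: "g K \<in> borel_measurable (Pi\<^sub>M {1..<K} (\<lambda>_. N))" for K
    unfolding g_def
  proof (rule borel_measurable_prod_ennreal)
    fix k assume k: "k \<in> {m..<K}"
    have r: "(\<lambda>x. restrict x {1..<k}) \<in> measurable (Pi\<^sub>M {1..<K} (\<lambda>_. N)) (Pi\<^sub>M {1..<k} (\<lambda>_. N))"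
      using k by (intro measurable_restrict_subset) auto
    have p: "(\<lambda>x. x k) \<in> measurable (Pi\<^sub>M {1..<K} (\<lambda>_. N)) N"
      using k m by (intro measurable_component_singleton) auto
    have "Measurable.pred (Pi\<^sub>M {1..<K} (\<lambda>_. N)) (\<lambda>x. restrict x {1..<k} \<in> S k)"
      by (rule pred_sets2[OF S r])
    moreover have "Measurable.pred (Pi\<^sub>M {1..<K} (\<lambda>_. N)) (\<lambda>x. x k \<in> B)"
      by (rule pred_sets2[OF B p])
    ultimately show "(\<lambda>x. if restrict x {1..<k} \<in> S k then (if x k \<in> B then 0 else ennreal c) else 1)
        \<in> borel_measurable (Pi\<^sub>M {1..<K} (\<lambda>_. N))"
      by (intro measurable_If) auto
  qed
  have past: "(\<lambda>\<omega>. \<lambda>i\<in>{1..<K}. Y i \<omega>) \<in> measurable M (Pi\<^sub>M {1..<K} (\<lambda>_. N))" for K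
    by (intro measurable_restrict Y) auto
  have W: "W K \<omega> = g K (\<lambda>i\<in>{1..<K}. Y i \<omega>)" for K \<omega>
    unfolding W_def g_def
  proof (intro prod.cong refl)
    fix k assume k: "k \<in> {m..<K}"
    then have "{1..<K} \<inter> {1..<k} = {1..<k}" "k \<in> {1..<K}" using m by auto
    then show "(if (\<lambda>i\<in>{1..<k}. Y i \<omega>) \<in> S k then (if Y k \<omega> \<in> B then 0 else ennreal c) else 1) =
      (if restrict (\<lambda>i\<in>{1..<K}. Y i \<omega>) {1..<k} \<in> S k then
        (if (\<lambda>i\<in>{1..<K}. Y i \<omega>) k \<in> B then 0 else ennreal c) else 1)"
      by (simp add: restrict_restrict)
  qed
  have Wm[measurable]: "W K \<in> borel_measurable M" for K
    unfolding W[abs_def] by (rule measurable_compose[OF past g])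
  have decr: "(\<integral>\<^sup>+\<omega>. W (Suc K) \<omega> \<partial>M) \<le> (\<integral>\<^sup>+\<omega>. W K \<omega> \<partial>M)" if K: "m \<le> K" for K
  proof -
    have K1: "1 \<le> K" using K m by simp
    let ?past = "\<lambda>\<omega>. \<lambda>i\<in>{1..<K}. Y i \<omega>"
    define g1 where "g1 x = g K x * indicator (S K) x" for x
    define g0 where "g0 x = g K x * indicator (- S K) x" for x
    have Sp: "Measurable.pred (Pi\<^sub>M {1..<K} (\<lambda>_. N)) (\<lambda>x. x \<in> S K)" using S[of K] by simp
    have g1: "g1 \<in> borel_measurable (Pi\<^sub>M {1..<K} (\<lambda>_. N))"
      and g0: "g0 \<in> borel_measurable (Pi\<^sub>M {1..<K} (\<lambda>_. N))"
      unfolding g1_def g0_def indicator_def using Sp by measurable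
    have h: "(indicator (- B) :: 'b \<Rightarrow> ennreal) \<in> borel_measurable N"
    proof -
      have "Measurable.pred N (\<lambda>x. x \<in> B)" using B by simp
      then show ?thesis unfolding indicator_def by measurable
    qed
    have m1: "(\<lambda>\<omega>. g1 (?past \<omega>)) \<in> borel_measurable M" "(\<lambda>\<omega>. g0 (?past \<omega>)) \<in> borel_measurable M"
      by (rule measurable_compose[OF past g1], rule measurable_compose[OF past g0])
    have m2: "(\<lambda>\<omega>. indicator (- B) (Y K \<omega>) :: ennreal) \<in> borel_measurable M"
      by (rule measurable_compose[OF Y[OF K1] h])
    have "{m..<Suc K} = insert K {m..<K}" using K by auto
    then have "W (Suc K) \<omega> = g0 (?past \<omega>) + ennreal c * (g1 (?past \<omega>) * indicator (- B) (Y K \<omega>))" for \<omega>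
      unfolding g1_def g0_def W[symmetric] by (simp add: W_def indicator_def mult.commute)
    then have "(\<integral>\<^sup>+\<omega>. W (Suc K) \<omega> \<partial>M)
        = (\<integral>\<^sup>+\<omega>. g0 (?past \<omega>) \<partial>M) + ennreal c * (\<integral>\<^sup>+\<omega>. g1 (?past \<omega>) * indicator (- B) (Y K \<omega>) \<partial>M)"
      using m1 m2 by (simp add: nn_integral_add nn_integral_cmult)
    also have "(\<integral>\<^sup>+\<omega>. g1 (?past \<omega>) * indicator (- B) (Y K \<omega>) \<partial>M)
        = (\<integral>\<^sup>+\<omega>. g1 (?past \<omega>) \<partial>M) * (\<integral>\<^sup>+\<omega>. indicator (- B) (Y K \<omega>) \<partial>M)"
      by (rule indep_var_nn_integral_mult[OF indep_past_present[OF indep K1 g1 h]])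
    also have "(\<integral>\<^sup>+\<omega>. indicator (- B) (Y K \<omega>) \<partial>M) = ennreal (prob {\<omega> \<in> space M. Y K \<omega> \<notin> B})"
    proof -
      have "{\<omega> \<in> space M. Y K \<omega> \<notin> B} = space M - Y K -` B \<inter> space M" by auto
      then have "{\<omega> \<in> space M. Y K \<omega> \<notin> B} \<in> sets M" using measurable_sets[OF Y[OF K1] B] by auto
      moreover have "(\<integral>\<^sup>+\<omega>. indicator (- B) (Y K \<omega>) \<partial>M) = (\<integral>\<^sup>+\<omega>. indicator {\<omega> \<in> space M. Y K \<omega> \<notin> B} \<omega> \<partial>M)"
        by (intro nn_integral_cong) (simp add: indicator_def)
      ultimately show ?thesis by (simp add: emeasure_eq_measure)
    qed
    also have "ennreal c * ((\<integral>\<^sup>+\<omega>. g1 (?past \<omega>) \<partial>M) * ennreal (prob {\<omega> \<in> space M. Y K \<omega> \<notin> B}))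
        = (\<integral>\<^sup>+\<omega>. g1 (?past \<omega>) \<partial>M) * ennreal (c * prob {\<omega> \<in> space M. Y K \<omega> \<notin> B})"
      using c(1) by (simp add: ennreal_mult mult_ac)
    also have "\<dots> \<le> (\<integral>\<^sup>+\<omega>. g1 (?past \<omega>) \<partial>M) * 1"
      using c(2)[OF K1] by (intro mult_left_mono) (simp_all add: ennreal_le_1)
    also have "(\<integral>\<^sup>+\<omega>. g0 (?past \<omega>) \<partial>M) + (\<integral>\<^sup>+\<omega>. g1 (?past \<omega>) \<partial>M) * 1
        = (\<integral>\<^sup>+\<omega>. g0 (?past \<omega>) + g1 (?past \<omega>) \<partial>M)"
      using m1 by (simp add: nn_integral_add)
    also have "\<dots> = (\<integral>\<^sup>+\<omega>. W K \<omega> \<partial>M)"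
      unfolding g0_def g1_def W by (intro nn_integral_cong) (simp add: indicator_def)
    finally show ?thesis by (simp add: add_left_mono)
  qed
  have "(\<integral>\<^sup>+\<omega>. W K \<omega> \<partial>M) \<le> 1" if "m \<le> K" for K
    using that
  proof (induction K rule: dec_induct)
    case base show ?case by (simp add: W_def emeasure_space_1)
  next
    case (step K) then show ?case using decr[of K] by (meson order_trans)
  qed
  then have "\<forall>\<^sub>F K in sequentially. (\<integral>\<^sup>+\<omega>. W K \<omega> \<partial>M) \<le> 1"
    unfolding eventually_sequentially by blast
  then have "liminf (\<lambda>K. \<integral>\<^sup>+\<omega>. W K \<omega> \<partial>M) \<le> 1"
    using Liminf_mono[of "\<lambda>K. \<integral>\<^sup>+\<omega>. W K \<omega> \<partial>M" "\<lambda>_. 1" sequentially]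
    by (simp add: Liminf_const)
  then have "(\<integral>\<^sup>+\<omega>. liminf (\<lambda>K. W K \<omega>) \<partial>M) \<le> 1"
    using nn_integral_liminf[of W M] by (meson Wm order_trans)
  then have "(\<integral>\<^sup>+\<omega>. liminf (\<lambda>K. W K \<omega>) \<partial>M) \<noteq> \<infinity>" by (auto simp: top_unique)
  then show ?thesis using nn_integral_noteq_infinite[of "\<lambda>\<omega>. liminf (\<lambda>K. W K \<omega>)" M] by simp
qed

text \<open>A conditional form of the second Borel--Cantelli lemma: if infinitely many trials are selected by a rule
  that looks at past outcomes only, infinitely many of the selected trials succeed. Otherwise the weights
  of the previous lemma grow without bound, as they are eventually multiplied by \<open>c > 1\<close> at each selected
  trial and never reset. On \<open>G\<close> the past takes finitely many values at
  each time and \<open>A k\<close> is a function of it, so \<open>A k\<close> coincides there with a measurable event, although \<open>A\<close>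
  and \<open>G\<close> are arbitrary.\<close>

lemma predictable_infinitely_often:
  fixes Y :: "nat \<Rightarrow> 'a \<Rightarrow> 'b"
  assumes indep: "indep_vars (\<lambda>_. N) Y {1..}"
    and F: "finite F" "\<And>y. y \<in> F \<Longrightarrow> {y} \<in> sets N"
    and B: "B \<in> sets N" and p: "0 < p" "\<And>k. 1 \<le> k \<Longrightarrow> p \<le> prob {\<omega> \<in> space M. Y k \<omega> \<in> B}"
    and G: "AE \<omega> in M. \<omega> \<in> G" "\<And>k \<omega>. \<omega> \<in> G \<Longrightarrow> 1 \<le> k \<Longrightarrow> Y k \<omega> \<in> F"
    and A: "\<And>k \<omega> \<omega>'. 1 \<le> k \<Longrightarrow> \<omega> \<in> G \<Longrightarrow> \<omega>' \<in> G \<Longrightarrow> \<forall>i\<in>{1..<k}. Y i \<omega> = Y i \<omega>' \<Longrightarrow> A k \<omega> \<Longrightarrow> A k \<omega>'"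
  shows "AE \<omega> in M. (\<exists>\<^sub>F k in sequentially. A k \<omega>) \<longrightarrow> (\<exists>\<^sub>F k in sequentially. A k \<omega> \<and> Y k \<omega> \<in> B)"
proof -
  define S where "S k = {f \<in> {1..<k} \<rightarrow>\<^sub>E F. \<exists>\<omega>\<in>G. (\<forall>i\<in>{1..<k}. Y i \<omega> = f i) \<and> A k \<omega>}" for k
  have S: "S k \<in> sets (Pi\<^sub>M {1..<k} (\<lambda>_. N))" for k
  proof -
    have "finite (S k)" unfolding S_def
      using finite_PiE[of "{1..<k}" "\<lambda>_. F"] F(1) by simp
    moreover have "{f} \<in> sets (Pi\<^sub>M {1..<k} (\<lambda>_. N))" if "f \<in> S k" for f
    proof -
      have f: "f \<in> {1..<k} \<rightarrow>\<^sub>E F" using that by (simp add: S_def)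
      then have "{f} = Pi\<^sub>E {1..<k} (\<lambda>i. {f i})"
        by (intro equalityI subsetI) (auto simp: PiE_iff intro!: extensionalityI[of _ "{1..<k}"])
      also have "\<dots> \<in> sets (Pi\<^sub>M {1..<k} (\<lambda>_. N))"
        using f F(2) by (intro sets_PiM_I_finite) (auto simp: PiE_iff)
      finally show ?thesis .
    qed
    ultimately show ?thesis by (metis countable_finite sets.countable)
  qed
  have AS: "A k \<omega> \<longleftrightarrow> (\<lambda>i\<in>{1..<k}. Y i \<omega>) \<in> S k" if "\<omega> \<in> G" "1 \<le> k" for k \<omega>
  proof
    assume "A k \<omega>"
    then show "(\<lambda>i\<in>{1..<k}. Y i \<omega>) \<in> S k"
      unfolding S_def using that G(2) by (auto intro!: bexI[of _ \<omega>])
  next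
    assume "(\<lambda>i\<in>{1..<k}. Y i \<omega>) \<in> S k"
    then obtain \<omega>' where "\<omega>' \<in> G" "\<forall>i\<in>{1..<k}. Y i \<omega>' = Y i \<omega>" "A k \<omega>'"
      unfolding S_def by auto
    then show "A k \<omega>" using A that by blast
  qed
  \<comment> \<open>\<open>p / 2\<close> instead of \<open>p\<close>, so that the denominator is positive even when \<open>p = 1\<close>\<close>
  define c where "c = 1 / (1 - p / 2)"
  have p1: "p \<le> 1" using p(2)[of 1] prob_le_1 by (meson order_refl order_trans)
  have c: "1 < c" using p p1 by (simp add: c_def)
  have cB: "c * prob {\<omega> \<in> space M. Y k \<omega> \<notin> B} \<le> 1" if "1 \<le> k" for k
  proof -
    have "Y k \<in> measurable M N" using indep that unfolding indep_vars_def by simp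
    then have "{\<omega> \<in> space M. Y k \<omega> \<in> B} \<in> events"
      using measurable_sets[OF _ B] by (simp add: vimage_def Int_def conj_commute)
    then have "prob {\<omega> \<in> space M. Y k \<omega> \<notin> B} = 1 - prob {\<omega> \<in> space M. Y k \<omega> \<in> B}"
      using prob_neg[of "\<lambda>\<omega>. Y k \<omega> \<in> B"] by simp
    also have "\<dots> \<le> 1 - p / 2" using p(2)[OF that] p(1) by simp
    finally show ?thesis using p1 by (simp add: c_def divide_le_eq)
  qed
  let ?W = "\<lambda>m K \<omega>. \<Prod>k\<in>{m..<K}. if (\<lambda>i\<in>{1..<k}. Y i \<omega>) \<in> S k then (if Y k \<omega> \<in> B then 0 else ennreal c) else 1"
  have "AE \<omega> in M. liminf (\<lambda>K. ?W (Suc m) K \<omega>) \<noteq> \<top>" for m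
    by (rule avoidance_weights_finite[OF indep S B _ cB]) (use c in auto)
  then have "AE \<omega> in M. \<forall>m. liminf (\<lambda>K. ?W (Suc m) K \<omega>) \<noteq> \<top>"
    by (simp add: AE_all_countable)
  with G(1) show ?thesis
  proof eventually_elim
    case (elim \<omega>)
    show ?case
    proof (intro impI, rule ccontr)
      assume io: "\<exists>\<^sub>F k in sequentially. A k \<omega>"
        and "\<not> (\<exists>\<^sub>F k in sequentially. A k \<omega> \<and> Y k \<omega> \<in> B)"
      then have "\<forall>\<^sub>F k in sequentially. \<not> (A k \<omega> \<and> Y k \<omega> \<in> B)" by (simp add: not_frequently)
      then obtain m where m: "\<And>k. m \<le> k \<Longrightarrow> \<not> (A k \<omega> \<and> Y k \<omega> \<in> B)"
        unfolding eventually_sequentially by blast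
      have W: "?W (Suc m) K \<omega> = ennreal (c ^ card {k \<in> {Suc m..<K}. A k \<omega>})" for K
      proof -
        have "?W (Suc m) K \<omega> = (\<Prod>k\<in>{Suc m..<K}. if A k \<omega> then ennreal c else 1)"
        proof (intro prod.cong refl)
          fix k assume "k \<in> {Suc m..<K}"
          then show "(if (\<lambda>i\<in>{1..<k}. Y i \<omega>) \<in> S k then (if Y k \<omega> \<in> B then 0 else ennreal c) else 1)
              = (if A k \<omega> then ennreal c else 1)"
            using AS[OF elim(1), of k] m[of k] by auto
        qed
        also have "\<dots> = ennreal c ^ card {k \<in> {Suc m..<K}. A k \<omega>}"
          by (subst prod.inter_filter[symmetric]) simp_all
        finally show ?thesis using c by (simp add: ennreal_power)
      qed
      have inf: "infinite {k. Suc m \<le> k \<and> A k \<omega>}"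
      proof -
        have "infinite {k. A k \<omega>}" using io by (simp add: frequently_cofinite flip: cofinite_eq_sequentially)
        moreover have "{k. A k \<omega>} \<subseteq> {..m} \<union> {k. Suc m \<le> k \<and> A k \<omega>}" by auto
        ultimately show ?thesis by (meson finite_UnI finite_atMost finite_subset)
      qed
      have "\<top> \<le> liminf (\<lambda>K. ?W (Suc m) K \<omega>)"
        unfolding le_Liminf_iff
      proof (intro allI impI)
        fix y :: ennreal assume "y < \<top>"
        then obtain r where r: "y = ennreal r" "0 \<le> r" by (cases y) auto
        obtain N where N: "r < c ^ N" using real_arch_pow[OF c] by blast
        obtain D where D: "D \<subseteq> {k. Suc m \<le> k \<and> A k \<omega>}" "finite D" "card D = N"
          using infinite_arbitrarily_large[OF inf] by blast
        show "\<forall>\<^sub>F K in sequentially. y < ?W (Suc m) K \<omega>"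
          unfolding W eventually_sequentially
        proof (intro exI allI impI)
          fix K assume K: "Suc (Max D) \<le> K"
          have "k < K" if "k \<in> D" for k using Max_ge[OF D(2) that] K by simp
          then have "D \<subseteq> {k \<in> {Suc m..<K}. A k \<omega>}" using D by auto
          then have "card D \<le> card {k \<in> {Suc m..<K}. A k \<omega>}" by (intro card_mono) simp_all
          then have "N \<le> card {k \<in> {Suc m..<K}. A k \<omega>}" using D(3) by simp
          then have "c ^ N \<le> c ^ card {k \<in> {Suc m..<K}. A k \<omega>}" using c by (simp add: power_increasing)
          then show "y < ennreal (c ^ card {k \<in> {Suc m..<K}. A k \<omega>})"
            using N r by (simp add: ennreal_less_iff)
        qed
      qed
      then show False using elim(2) by (simp add: top_unique)
    qed
  qed
qed

end

section \<open>Measurability of the gaps and the law of the samples\<close>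

text \<open>Two runs with the same samples, node decisions and backward solutions up to iteration \<open>k\<close> produce the same
  approximations on the state sets: the samples determine the node that is visited, its decision is the trial
  point, and the trial point and the backward solutions determine the cut. This makes the gaps predictable.\<close>

lemma approximations_determined:
  assumes R: "isddp_simulation P e \<delta> \<epsilon> Q0 s xf xb lam Q xn"
    and R': "isddp_simulation P e \<delta> \<epsilon> Q0 s' xf' xb' lam' Q' xn'"
    and s_supp: "\<And>i t. 1 \<le> i \<Longrightarrow> i \<le> k \<Longrightarrow> t \<in> {2..horizon P} \<Longrightarrow> s i t \<in> supp P t"
    and same: "\<And>i t. 1 \<le> i \<Longrightarrow> i \<le> k \<Longrightarrow> t \<in> {2..horizon P} \<Longrightarrow> s' i t = s i t"
    and xn: "\<And>i t n. 1 \<le> i \<Longrightarrow> i \<le> k \<Longrightarrow> t \<le> horizon P \<Longrightarrow> n \<in> nodes P t \<Longrightarrow> xn' i n = xn i n"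
    and xb: "\<And>i t v. 1 \<le> i \<Longrightarrow> i \<le> k \<Longrightarrow> t \<in> {2..horizon P} \<Longrightarrow> v \<in> supp P t \<Longrightarrow>
      xb' i t v = xb i t v \<and> lam' i t v = lam i t v"
    and t: "t \<in> {2..Suc (horizon P)}" and x: "x \<in> state_set P (t - 1)"
  shows "Q' k t x = Q k t x"
proof -
  interpret R: isddp_simulation P e \<delta> \<epsilon> Q0 s xf xb lam Q xn by (rule R)
  interpret R': isddp_simulation P e \<delta> \<epsilon> Q0 s' xf' xb' lam' Q' xn' by (rule R')
  have xf: "xf' i (t - 1) = xf i (t - 1)" if i: "1 \<le> i" "i \<le> k" and t: "t \<in> {2..R.T}" for i t
  proof -
    let ?n = "map (s i) [1..<t]"
    have s1: "s i 1 = xi_first P" "s' i 1 = xi_first P"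
      using R.forward[OF i(1)] R'.forward[OF i(1)] by (simp_all add: forward_pass_def)
    have in_supp: "s i r \<in> supp P r" if "1 \<le> r" "r < t" for r
      using s_supp[OF i, of r] s1(1) R.supp_first t that by (cases "r = 1") auto
    have eq: "s' i r = s i r" if "1 \<le> r" "r < t" for r
      using same[OF i, of r] s1 t that by (cases "r = 1") auto
    have n: "?n \<in> nodes P (t - 1)" using in_supp by (auto simp: nodes_def)
    have len: "Suc (length ?n) = t" using t by auto
    have "passes_through (s i) ?n" "passes_through (s' i) ?n"
      unfolding passes_through_def len using eq by auto
    moreover have "t - 1 \<le> R.T" using t by auto
    ultimately show ?thesis
      using R.coupled R'.coupled i n xn[OF i \<open>t - 1 \<le> R.T\<close> n] unfolding coupled_def by metis
  qed
  have "t \<le> Suc R.T" using t by simp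
  then have "\<forall>j\<le>k. \<forall>x\<in>state_set P (t - 1). Q' j t x = Q j t x" using t
  proof (induction t rule: inc_induct)
    case base
    then show ?case using R.Q_end R'.Q_end by simp
  next
    case (step t)
    then have t: "t \<in> {2..R.T}" and t': "t \<in> {2..Suc R.T}" "Suc t \<in> {2..Suc R.T}" by auto
    note IH = step.IH[OF t'(2), unfolded diff_Suc_1]
    have "\<forall>x\<in>state_set P (t - 1). Q' j t x = Q j t x" if "j \<le> k" for j
      using that
    proof (induction j)
      case 0
      show ?case using R.Q_start[OF t'(1)] R'.Q_start[OF t'(1)] by simp
    next
      case (Suc j)
      have j: "1 \<le> Suc j" "Suc j \<le> k" using Suc by auto
      note xbj = xb[OF j t] and xfj = xf[OF j t]
      have "R'.slope (Suc j) t = R.slope (Suc j) t"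
        unfolding R.slope_def R'.slope_def using xbj by (intro sum.cong) simp_all
      moreover have "R'.intercept (Suc j) t = R.intercept (Suc j) t"
      proof -
        have "xb (Suc j) t v \<in> state_set P t" if "v \<in> supp P t" for v
          using R.backward[OF j(1)] t that
          by (auto simp: backward_pass_def approx_min_def joint_feasible_def)
        then show ?thesis
          unfolding R.intercept_def R'.intercept_def using xbj xfj IH j(2) by simp
      qed
      ultimately show ?case
        using R.Q_update[OF j(1) t] R'.Q_update[OF j(1) t] Suc by simp
    qed
    then show ?case by blast
  qed
  then show ?thesis using x by blast
qed

context prob_space
begin

lemma weights_sum_to_1:
  fixes \<xi> :: "'a \<Rightarrow> 'b::t1_space"
  assumes "\<xi> \<in> borel_measurable M" "finite S" "AE \<omega> in M. \<xi> \<omega> \<in> S"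
  shows "(\<Sum>v\<in>S. prob {\<omega> \<in> space M. \<xi> \<omega> = v}) = 1"
proof -
  have ev: "{\<omega> \<in> space M. \<xi> \<omega> = v} \<in> events" for v
    using measurable_sets[OF assms(1) borel_singleton[OF sets.empty_sets, of v]]
    by (simp add: vimage_def Int_def conj_commute)
  have "(\<Sum>v\<in>S. prob {\<omega> \<in> space M. \<xi> \<omega> = v}) = prob (\<Union>v\<in>S. {\<omega> \<in> space M. \<xi> \<omega> = v})"
    by (rule finite_measure_finite_Union[symmetric])
      (use assms ev in \<open>auto simp: disjoint_family_on_def\<close>)
  also have "\<dots> = 1"
    using assms ev by (subst prob_eq_1) (auto intro!: sets.finite_UN)
  finally show ?thesis .
qed

text \<open>The law of each sampled scenario is that of the process, so samples lie in the finite supports almost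
  surely, and a node is visited with a positive probability that is the same for all iterations: the
  product of its transition probabilities. Stage 1 is deterministic and not part of the sampled vector,
  which is why the coordinates of a node are compared from index 1 on only.\<close>

lemma sampled_scenarios:
  fixes P :: "('n::finite, 'q::finite, 'K::finite) msp"
  assumes H: "hyp_H P M \<xi>" and H2: "hyp_H2 P M \<xi> \<xi>s"
  defines "N \<equiv> Pi\<^sub>M {2..horizon P} (\<lambda>_. borel :: (real^'K) measure)"
    and "Y \<equiv> \<lambda>k \<omega>. \<lambda>t\<in>{2..horizon P}. \<xi>s k t \<omega>"
  shows "AE \<omega> in M. \<forall>k\<ge>1. Y k \<omega> \<in> Pi\<^sub>E {2..horizon P} (supp P)"
    and "t \<in> {2..horizon P} \<Longrightarrow> n \<in> nodes P (t - 1) \<Longrightarrow>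
      \<exists>B p. B \<in> sets N \<and> 0 < p \<and> (\<forall>k\<ge>1. p \<le> prob {\<omega> \<in> space M. Y k \<omega> \<in> B})
        \<and> (\<forall>y\<in>space N. y \<in> B \<longleftrightarrow> (\<forall>r\<in>{1..<length n}. y (Suc r) = n ! r))"
proof -
  let ?I = "{2..horizon P}"
  define X where "X \<omega> = (\<lambda>t\<in>?I. \<xi> t \<omega>)" for \<omega>
  have indep: "indep_vars (\<lambda>_. borel) \<xi> {1..horizon P}"
    and fin: "\<And>t. t \<in> {1..horizon P} \<Longrightarrow> finite (supp P t)"
    and AE: "\<And>t. t \<in> {1..horizon P} \<Longrightarrow> AE \<omega> in M. \<xi> t \<omega> \<in> supp P t"
    and prb: "\<And>t v. t \<in> {1..horizon P} \<Longrightarrow> v \<in> supp P t \<Longrightarrow>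
      0 < prob {\<omega> \<in> space M. \<xi> t \<omega> = v}"
    using H unfolding hyp_H_def by force+
  have \<xi>: "\<xi> t \<in> borel_measurable M" if "t \<in> {1..horizon P}" for t
    using indep that unfolding indep_vars_def by simp
  have X: "X \<in> measurable M N" unfolding X_def[abs_def] N_def
    by (intro measurable_restrict \<xi>) auto
  have Y: "Y k \<in> measurable M N" if "1 \<le> k" for k
    using H2 that unfolding hyp_H2_def indep_vars_def Y_def N_def by auto
  have dist: "distr M N (Y k) = distr M N X" if "1 \<le> k" for k
    using H2 that unfolding hyp_H2_def Y_def N_def X_def[abs_def] by auto
  have F: "Pi\<^sub>E ?I (supp P) \<in> sets N" unfolding N_def
    by (intro sets_PiM_I_finite) (use fin in \<open>auto intro!: borel_closed finite_imp_closed\<close>)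
  have "AE \<omega> in M. \<forall>t\<in>?I. \<xi> t \<omega> \<in> supp P t"
    by (rule AE_finite_allI) (use AE in auto)
  then have "AE \<omega> in M. X \<omega> \<in> Pi\<^sub>E ?I (supp P)"
    by eventually_elim (auto simp: X_def)
  then have "AE y in distr M N X. y \<in> Pi\<^sub>E ?I (supp P)"
    using F X by (subst AE_distr_iff) auto
  then have "AE \<omega> in M. Y k \<omega> \<in> Pi\<^sub>E ?I (supp P)" if "1 \<le> k" for k
    using F Y[OF that] unfolding dist[OF that, symmetric] by (subst (asm) AE_distr_iff) auto
  then show "AE \<omega> in M. \<forall>k\<ge>1. Y k \<omega> \<in> Pi\<^sub>E ?I (supp P)"
    unfolding AE_all_countable by (auto intro: AE_I2)
  show "\<exists>B p. B \<in> sets N \<and> 0 < p \<and> (\<forall>k\<ge>1. p \<le> prob {\<omega> \<in> space M. Y k \<omega> \<in> B})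
        \<and> (\<forall>y\<in>space N. y \<in> B \<longleftrightarrow> (\<forall>r\<in>{1..<length n}. y (Suc r) = n ! r))"
    if t: "t \<in> ?I" and n: "n \<in> nodes P (t - 1)"
  proof -
    have len: "length n = t - 1" and n_supp: "\<And>r. r < t - 1 \<Longrightarrow> n ! r \<in> supp P (Suc r)"
      using n by (auto simp: nodes_def)
    have idx: "Suc r \<in> ?I" "Suc r \<in> {1..horizon P}" if "r \<in> {1..<length n}" for r
      using that t len by auto
    define B where "B = {y \<in> space N. \<forall>r\<in>{1..<length n}. y (Suc r) = n ! r}"
    have B: "B \<in> sets N"
    proof -
      have "{y \<in> space N. y (Suc r) \<in> {n ! r}} \<in> sets N" if "r \<in> {1..<length n}" for r
        using idx(1)[OF that] unfolding N_def
        by (intro measurable_sets_Collect[OF measurable_component_singleton]) auto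
      then show ?thesis unfolding B_def by (intro sets.sets_Collect_finite_All) auto
    qed
    have pre: "{\<omega> \<in> space M. X \<omega> \<in> B} = {\<omega> \<in> space M. \<forall>r\<in>{1..<length n}. \<xi> (Suc r) \<omega> = n ! r}"
      using measurable_space[OF X] idx unfolding B_def by (auto simp: X_def)
    have pos: "0 < prob {\<omega> \<in> space M. X \<omega> \<in> B}"
    proof (cases "{1..<length n} = {}")
      case True
      then show ?thesis unfolding pre by (simp add: prob_space)
    next
      case False
      let ?J = "Suc ` {1..<length n}"
      have "{\<omega> \<in> space M. \<forall>r\<in>{1..<length n}. \<xi> (Suc r) \<omega> = n ! r}
          = (\<Inter>r\<in>{1..<length n}. \<xi> (Suc r) -` {n ! r} \<inter> space M)"
        using False by auto
      also have "\<dots> = (\<Inter>i\<in>?J. \<xi> i -` {n ! (i - 1)} \<inter> space M)"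
        unfolding image_image by simp
      finally have "{\<omega> \<in> space M. \<forall>r\<in>{1..<length n}. \<xi> (Suc r) \<omega> = n ! r}
          = (\<Inter>i\<in>?J. \<xi> i -` {n ! (i - 1)} \<inter> space M)" .
      moreover have "prob (\<Inter>i\<in>?J. \<xi> i -` {n ! (i - 1)} \<inter> space M)
          = (\<Prod>i\<in>?J. prob (\<xi> i -` {n ! (i - 1)} \<inter> space M))"
      proof (rule indep_varsD[OF indep])
        show "?J \<subseteq> {1..horizon P}" using idx(2) by blast
      qed (use False in auto)
      moreover have "0 < prob (\<xi> i -` {n ! (i - 1)} \<inter> space M)" if "i \<in> ?J" for i
      proof -
        obtain r where r: "i = Suc r" "r \<in> {1..<length n}" using \<open>i \<in> ?J\<close> by blast
        then have "n ! r \<in> supp P i" using n_supp len by simp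
        moreover have "\<xi> i -` {n ! (i - 1)} \<inter> space M = {\<omega> \<in> space M. \<xi> i \<omega> = n ! r}"
          using r by auto
        ultimately show ?thesis using prb[of i] idx(2) r by auto
      qed
      ultimately show ?thesis unfolding pre by (metis (no_types, lifting) prod_pos)
    qed
    have "prob {\<omega> \<in> space M. Y k \<omega> \<in> B} = prob {\<omega> \<in> space M. X \<omega> \<in> B}" if k: "1 \<le> k" for k
    proof -
      have "{\<omega> \<in> space M. Y k \<omega> \<in> B} = Y k -` B \<inter> space M" "{\<omega> \<in> space M. X \<omega> \<in> B} = X -` B \<inter> space M"
        by auto
      then show ?thesis
        using measure_distr[OF Y[OF k] B] measure_distr[OF X B] dist[OF k] by simp
    qed
    then show ?thesis using B pos
      by (intro exI[of _ B] exI[of _ "prob {\<omega> \<in> space M. X \<omega> \<in> B}"]) (auto simp: B_def)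
  qed
qed

end

text \<open>The weights of each stage sum to 1, as they are the probabilities of the points of the support.\<close>

lemma convex_msp_of_hypotheses:
  assumes "prob_space M" "horizon P \<ge> 1" "hyp_H P M \<xi>" "hyp_H1 P"
  obtains e where "convex_msp P e"
proof -
  interpret prob_space M by fact
  have H: "indep_vars (\<lambda>_. borel) \<xi> {1..horizon P}" "supp P 1 = {xi_first P}"
    "\<forall>t\<in>{1..horizon P}. finite (supp P t)"
    "\<forall>t\<in>{1..horizon P}. AE \<omega> in M. \<xi> t \<omega> \<in> supp P t"
    "\<forall>t\<in>{1..horizon P}. \<forall>v\<in>supp P t. prb P t v = prob {\<omega> \<in> space M. \<xi> t \<omega> = v} \<and> prb P t v > 0"
    using assms(3) unfolding hyp_H_def by blast+
  have sum: "(\<Sum>v\<in>supp P t. prb P t v) = 1" if t: "t \<in> {1..horizon P}" for t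
  proof -
    have "\<xi> t \<in> borel_measurable M" using H(1) t unfolding indep_vars_def by simp
    then show ?thesis using weights_sum_to_1[of "\<xi> t" "supp P t"] H(3-5) t by simp
  qed
  obtain e where e: "e > 0" and H1: "\<forall>t\<in>{1..horizon P}.
        (state_set P t \<noteq> {} \<and> compact (state_set P t) \<and> convex (state_set P t)) \<and>
        (\<forall>v\<in>supp P t.
           ereal_convex (\<lambda>(x, z). cost P t x z v) \<and>
           ereal_proper (\<lambda>(x, z). cost P t x z v) \<and>
           lsc_on (state_set P t \<times> state_set P (t - 1)) (\<lambda>(x, z). cost P t x z v) \<and>
           (\<forall>z\<in>enlarge e (state_set P (t - 1)). \<forall>x\<in>state_set P t. cost P t x z v < \<infinity>)) \<and>
        (\<forall>v\<in>supp P t. \<forall>i\<in>{1..ineq_dim P}.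
           ereal_convex (\<lambda>(x, z). ineq P t i x z v) \<and>
           lsc_on (state_set P t \<times> state_set P (t - 1)) (\<lambda>(x, z). ineq P t i x z v) \<and>
           (\<forall>x\<in>state_set P t. \<forall>z\<in>state_set P (t - 1). \<bar>ineq P t i x z v\<bar> \<noteq> \<infinity>)) \<and>
        (t = 1 \<longrightarrow> feasible P 1 (x_init P) (xi_first P) \<noteq> {}) \<and>
        (t \<ge> 2 \<longrightarrow> (\<forall>v\<in>supp P t. \<forall>z\<in>enlarge e (state_set P (t - 1)).
           rel_interior (state_set P t) \<inter> feasible P t z v \<noteq> {})) \<and>
        (t \<ge> 2 \<longrightarrow> (\<forall>v\<in>supp P t.
           \<exists>x\<in>rel_interior (state_set P t). \<exists>z\<in>state_set P (t - 1).
             \<forall>i\<in>{1..ineq_dim P}. ineq P t i x z v < 0))"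
    and init: "state_set P 0 = {x_init P}"
    using assms(4) unfolding hyp_H1_def by (elim conjE exE) (rule that)
  have "convex_msp P e"
  proof
    show "0 < e" "state_set P 0 = {x_init P}" "1 \<le> horizon P" "supp P 1 = {xi_first P}" by fact+
    show "feasible P 1 (x_init P) (xi_first P) \<noteq> {}"
      using bspec[OF H1, of 1] assms(2) by simp
    fix t assume t: "t \<in> {1..horizon P}"
    note Ht = bspec[OF H1 t]
    show "finite (supp P t)" "(\<Sum>v\<in>supp P t. prb P t v) = 1" using H(3) sum t by blast+
    show "state_set P t \<noteq> {} \<and> compact (state_set P t) \<and> convex (state_set P t)"
      using Ht by (elim conjE) (intro conjI)
    fix v assume v: "v \<in> supp P t"
    show "0 < prb P t v" using H(5) t v by blast
    have cost: "\<forall>v\<in>supp P t.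
           ereal_convex (\<lambda>(x, z). cost P t x z v) \<and>
           ereal_proper (\<lambda>(x, z). cost P t x z v) \<and>
           lsc_on (state_set P t \<times> state_set P (t - 1)) (\<lambda>(x, z). cost P t x z v) \<and>
           (\<forall>z\<in>enlarge e (state_set P (t - 1)). \<forall>x\<in>state_set P t. cost P t x z v < \<infinity>)"
      using Ht by (elim conjE)
    show "ereal_convex (\<lambda>(x, z). cost P t x z v)" "ereal_proper (\<lambda>(x, z). cost P t x z v)"
      "lsc_on (state_set P t \<times> state_set P (t - 1)) (\<lambda>(x, z). cost P t x z v)"
      using bspec[OF cost v] by - (elim conjE, assumption)+
    show "cost P t x z v < \<infinity>" if "z \<in> enlarge e (state_set P (t - 1))" "x \<in> state_set P t" for x z
      using bspec[OF cost v] that by blast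
    show "ereal_convex (\<lambda>(x, z). ineq P t i x z v)" if "i \<in> {1..ineq_dim P}" for i
    proof -
      have "\<forall>v\<in>supp P t. \<forall>i\<in>{1..ineq_dim P}.
           ereal_convex (\<lambda>(x, z). ineq P t i x z v) \<and>
           lsc_on (state_set P t \<times> state_set P (t - 1)) (\<lambda>(x, z). ineq P t i x z v) \<and>
           (\<forall>x\<in>state_set P t. \<forall>z\<in>state_set P (t - 1). \<bar>ineq P t i x z v\<bar> \<noteq> \<infinity>)"
        using Ht by (elim conjE)
      then show ?thesis using v that by blast
    qed
  next
    fix t v z
    assume t: "t \<in> {2..horizon P}" and v: "v \<in> supp P t" and z: "z \<in> enlarge e (state_set P (t - 1))"
    have t1: "t \<in> {1..horizon P}" "t \<ge> 2" using t by auto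
    have "t \<ge> 2 \<longrightarrow> (\<forall>v\<in>supp P t. \<forall>z\<in>enlarge e (state_set P (t - 1)).
           rel_interior (state_set P t) \<inter> feasible P t z v \<noteq> {})"
      using bspec[OF H1 t1(1)] by (elim conjE)
    then show "feasible P t z v \<noteq> {}" using t1(2) v z by blast
  qed
  then show ?thesis by (rule that)
qed

section \<open>Almost sure convergence\<close>

theorem theorem5p4:
  fixes P :: "('n::finite, 'q::finite, 'K::finite) msp"
    and M :: "'w measure"
    and \<xi> :: "nat \<Rightarrow> 'w \<Rightarrow> real^'K"
    and \<xi>s :: "nat \<Rightarrow> nat \<Rightarrow> 'w \<Rightarrow> real^'K"
    and \<delta> \<epsilon> :: "nat \<Rightarrow> nat \<Rightarrow> real"
    and Q0 :: "nat \<Rightarrow> real^'n \<Rightarrow> real"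
    and xf :: "nat \<Rightarrow> nat \<Rightarrow> 'w \<Rightarrow> real^'n"
    and xb lam :: "nat \<Rightarrow> nat \<Rightarrow> real^'K \<Rightarrow> 'w \<Rightarrow> real^'n"
    and Q :: "nat \<Rightarrow> nat \<Rightarrow> 'w \<Rightarrow> real^'n \<Rightarrow> real"
    and xn :: "nat \<Rightarrow> (real^'K) list \<Rightarrow> 'w \<Rightarrow> real^'n"
  assumes "prob_space M"
    and "horizon P \<ge> 1"
    and "hyp_H P M \<xi>"
    and "hyp_H1 P"
    and "hyp_H2 P M \<xi> \<xi>s"
    and "\<forall>t\<in>{1..horizon P}. \<forall>k\<ge>1. \<delta> t k \<ge> 0"
    and "\<forall>t\<in>{2..horizon P}. \<forall>k\<ge>1. \<epsilon> t k \<ge> 0"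
    and "\<forall>t\<in>{1..horizon P}. (\<lambda>k. \<delta> t k) \<longlonglongrightarrow> 0"
    and "\<forall>t\<in>{2..horizon P}. (\<lambda>k. \<epsilon> t k) \<longlonglongrightarrow> 0"
    and "isddp_init P Q0"
    and "AE \<omega> in M. isddp_run P \<delta> \<epsilon> Q0 (\<lambda>k t. \<xi>s k t \<omega>) (\<lambda>k t. xf k t \<omega>)
           (\<lambda>k t v. xb k t v \<omega>) (\<lambda>k t v. lam k t v \<omega>) (\<lambda>k t. Q k t \<omega>)"
    and "AE \<omega> in M. simulation P \<delta> (\<lambda>k t. Q k t \<omega>) (\<lambda>k n. xn k n \<omega>)"
    and "AE \<omega> in M. coupled P (\<lambda>k t. \<xi>s k t \<omega>) (\<lambda>k t. xf k t \<omega>) (\<lambda>k n. xn k n \<omega>)"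
    and "nonanticipative P M \<xi>s xn xb lam"
  shows "(AE \<omega> in M.
            (\<lambda>k. stage_value P 1 (\<lambda>x. ereal (Q (k - 1) 2 \<omega> x)) (x_init P) (xi_first P))
              \<longlonglongrightarrow> optimal_value P)
       \<and> (\<forall>t\<in>{2..horizon P}. AE \<omega> in M.
            \<exists>Qs :: real^'n \<Rightarrow> real.
              continuous_on (state_set P (t - 1)) Qs \<and>
              uniform_limit (state_set P (t - 1)) (\<lambda>k. Q k t \<omega>) Qs sequentially \<and>
              (\<forall>n\<in>nodes P (t - 1). \<forall>xbar.
                 accumulation_point (\<lambda>k. xn k n \<omega>) xbar \<longrightarrow>
                 ereal (Qs xbar) = cost_to_go P t xbar))"
proof -
  interpret prob_space M by fact
  obtain e where e: "convex_msp P e"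
    using convex_msp_of_hypotheses[OF assms(1-4)] .
  interpret convex_msp P e by (rule e)
  define N where "N = Pi\<^sub>M {2..T} (\<lambda>_. borel :: (real^'K) measure)"
  define Y where "Y k \<omega> = (\<lambda>t\<in>{2..T}. \<xi>s k t \<omega>)" for k \<omega>
  define F where "F = Pi\<^sub>E {2..T} (supp P)"
  note samples = sampled_scenarios[OF assms(3,5), folded N_def Y_def F_def]
  define sims where "sims \<omega> \<longleftrightarrow> isddp_simulation P e \<delta> \<epsilon> Q0 (\<lambda>k t. \<xi>s k t \<omega>) (\<lambda>k t. xf k t \<omega>)
           (\<lambda>k t v. xb k t v \<omega>) (\<lambda>k t v. lam k t v \<omega>) (\<lambda>k t. Q k t \<omega>) (\<lambda>k n. xn k n \<omega>)" for \<omega>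
  define G where "G = {\<omega> \<in> space M. sims \<omega> \<and> (\<forall>k\<ge>1. Y k \<omega> \<in> F)}"
  have G: "AE \<omega> in M. \<omega> \<in> G"
    using assms(11-13) samples(1) AE_space
  proof eventually_elim
    case (elim \<omega>)
    have "sims \<omega>" unfolding sims_def
      by unfold_locales (use elim assms(7-10) in auto)
    then show ?case using elim by (simp add: G_def)
  qed
  define gap where "gap t n k \<omega> = ctg t (xn k n \<omega>) - Q (k - 1) t \<omega> (xn k n \<omega>)" for t n k \<omega>
  have indep: "indep_vars (\<lambda>_. N) Y {1..}"
    using assms(5) unfolding hyp_H2_def N_def Y_def[abs_def] by blast
  have F: "finite F" "\<And>y. y \<in> F \<Longrightarrow> {y} \<in> sets N"
  proof -
    show "finite F" unfolding F_def by (intro finite_PiE) (use supp_finite in auto)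
    fix y assume "y \<in> F"
    then have "{y} = Pi\<^sub>E {2..T} (\<lambda>i. {y i})"
      unfolding F_def by (intro equalityI subsetI) (auto simp: PiE_iff intro!: extensionalityI[of _ "{2..T}"])
    also have "\<dots> \<in> sets N" unfolding N_def by (intro sets_PiM_I_finite) auto
    finally show "{y} \<in> sets N" .
  qed
  have YF: "\<xi>s k t \<omega> \<in> supp P t" if "\<omega> \<in> G" "1 \<le> k" "t \<in> {2..T}" for k t \<omega>
  proof -
    have "Y k \<omega> \<in> F" using that by (simp add: G_def)
    then have "Y k \<omega> t \<in> supp P t" unfolding F_def using that(3) by (rule PiE_mem)
    then show ?thesis using that(3) by (simp add: Y_def)
  qed
  have same: "\<xi>s i t \<omega> = \<xi>s i t \<omega>'" if "Y i \<omega> = Y i \<omega>'" "t \<in> {2..T}" for i t \<omega> \<omega>'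
    using fun_cong[OF that(1), of t] that(2) by (simp add: Y_def)
  \<comment> \<open>the selection rule "the gap at \<open>n\<close> is large" looks at the samples before iteration \<open>k\<close> only\<close>
  have determined: "gap t n k \<omega> = gap t n k \<omega>'"
    if t: "t \<in> {2..T}" and n: "n \<in> nodes P (t - 1)" and k: "1 \<le> k" and \<omega>: "\<omega> \<in> G" "\<omega>' \<in> G"
      and Y: "\<forall>i\<in>{1..<k}. Y i \<omega> = Y i \<omega>'" for t n k \<omega> \<omega>'
  proof -
    have past: "same_samples P \<xi>s i \<omega> \<omega>'" if "i < k" for i
      unfolding same_samples_def
    proof (intro ballI)
      fix j r assume "j \<in> {1..i}" "r \<in> {2..T}"
      moreover from this have "Y j \<omega> = Y j \<omega>'" using Y that by simp
      ultimately show "\<xi>s j r \<omega> = \<xi>s j r \<omega>'" by (intro same)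
    qed
    have sp: "\<omega> \<in> space M" "\<omega>' \<in> space M" using \<omega> by (auto simp: G_def)
    have xn: "xn i m \<omega>' = xn i m \<omega>" if "1 \<le> i" "i \<le> k" "r \<le> T" "m \<in> nodes P r" for i r m
    proof -
      have "same_samples P \<xi>s (i - 1) \<omega> \<omega>'" using past that by simp
      then show ?thesis using assms(14) that sp unfolding nonanticipative_def by metis
    qed
    have xb: "xb i r v \<omega>' = xb i r v \<omega> \<and> lam i r v \<omega>' = lam i r v \<omega>"
      if "1 \<le> i" "i \<le> k - 1" "r \<in> {2..T}" "v \<in> supp P r" for i r v
    proof -
      have "same_samples P \<xi>s i \<omega> \<omega>'" using past that k by simp
      then show ?thesis using assms(14) that sp unfolding nonanticipative_def by metis
    qed
    have S: "sims \<omega>" "sims \<omega>'" using \<omega> by (auto simp: G_def)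
    interpret S: isddp_simulation P e \<delta> \<epsilon> Q0 "\<lambda>k t. \<xi>s k t \<omega>" "\<lambda>k t. xf k t \<omega>"
           "\<lambda>k t v. xb k t v \<omega>" "\<lambda>k t v. lam k t v \<omega>" "\<lambda>k t. Q k t \<omega>" "\<lambda>k n. xn k n \<omega>"
      using S(1) by (simp add: sims_def)
    have tT: "t - 1 \<in> {1..T}" "t - 1 \<le> T" "t \<in> {2..Suc T}" using t by auto
    have "Q (k - 1) t \<omega>' (xn k n \<omega>) = Q (k - 1) t \<omega> (xn k n \<omega>)"
    proof (rule approximations_determined[OF S[unfolded sims_def]])
      show "xn k n \<omega> \<in> state_set P (t - 1)" by (rule S.node_decision_mem[OF k tT(1) n])
      show "\<And>i t. 1 \<le> i \<Longrightarrow> i \<le> k - 1 \<Longrightarrow> t \<in> {2..T} \<Longrightarrow> \<xi>s i t \<omega> \<in> supp P t"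
        by (rule YF[OF \<omega>(1)])
      show "\<xi>s i t \<omega>' = \<xi>s i t \<omega>" if "1 \<le> i" "i \<le> k - 1" "t \<in> {2..T}" for i t
      proof -
        have "Y i \<omega> = Y i \<omega>'" using Y that k by simp
        then show ?thesis using that(3) by (intro same[symmetric])
      qed
      show "xn i m \<omega>' = xn i m \<omega>" if "1 \<le> i" "i \<le> k - 1" "r \<le> T" "m \<in> nodes P r" for i r m
        using xn[of i r m] that by simp
    qed (use xb tT in blast)+
    then show ?thesis using xn[OF k order_refl tT(2) n] by (simp add: gap_def)
  qed
  have io: "AE \<omega> in M. (\<exists>\<^sub>F k in sequentially. inverse (real (Suc j)) < gap t n k \<omega>) \<longrightarrow>
      (\<exists>\<^sub>F k in sequentially. inverse (real (Suc j)) < gap t n k \<omega> \<and> passes_through (\<lambda>t. \<xi>s k t \<omega>) n)"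
    if t: "t \<in> {2..T}" and n: "n \<in> nodes P (t - 1)" for t n j
  proof -
    obtain B p where B: "B \<in> sets N" "0 < p" "\<And>k. 1 \<le> k \<Longrightarrow> p \<le> prob {\<omega> \<in> space M. Y k \<omega> \<in> B}"
      and B_iff: "\<And>y. y \<in> space N \<Longrightarrow> y \<in> B \<longleftrightarrow> (\<forall>r\<in>{1..<length n}. y (Suc r) = n ! r)"
      using samples(2)[OF t n] by blast
    have pass: "passes_through (\<lambda>t. \<xi>s k t \<omega>) n" if \<omega>: "\<omega> \<in> G" and k: "1 \<le> k" and YB: "Y k \<omega> \<in> B" for k \<omega>
    proof -
      interpret S: isddp_simulation P e \<delta> \<epsilon> Q0 "\<lambda>k t. \<xi>s k t \<omega>" "\<lambda>k t. xf k t \<omega>"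
           "\<lambda>k t v. xb k t v \<omega>" "\<lambda>k t v. lam k t v \<omega>" "\<lambda>k t. Q k t \<omega>" "\<lambda>k n. xn k n \<omega>"
        using \<omega> by (simp add: sims_def G_def)
      have s1: "\<xi>s k 1 \<omega> = xi_first P" using S.forward[OF k] by (simp add: forward_pass_def)
      have len: "length n = t - 1" and n_supp: "\<And>r. r < t - 1 \<Longrightarrow> n ! r \<in> supp P (Suc r)"
        using n by (auto simp: nodes_def)
      have later: "\<forall>r\<in>{1..<length n}. Y k \<omega> (Suc r) = n ! r"
        using B_iff[of "Y k \<omega>"] sets.sets_into_space[OF B(1)] YB by blast
      have "n ! r = \<xi>s k (Suc r) \<omega>" if r: "r < length n" for r
      proof (cases "r = 0")
        case True
        then show ?thesis using n_supp[of 0] r len s1 supp_first by simp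
      next
        case False
        then have "Y k \<omega> (Suc r) = n ! r" using later r by simp
        moreover have "Suc r \<in> {2..T}" using False r len t by auto
        ultimately show ?thesis by (simp add: Y_def)
      qed
      then show ?thesis unfolding passes_through_def
        by (intro nth_equalityI) (auto simp del: upt_Suc)
    qed
    have "AE \<omega> in M. (\<exists>\<^sub>F k in sequentially. 1 \<le> k \<and> inverse (real (Suc j)) < gap t n k \<omega>) \<longrightarrow>
      (\<exists>\<^sub>F k in sequentially. (1 \<le> k \<and> inverse (real (Suc j)) < gap t n k \<omega>) \<and> Y k \<omega> \<in> B)"
    proof (rule predictable_infinitely_often[OF indep F B G])
      show "\<And>k \<omega>. \<omega> \<in> G \<Longrightarrow> 1 \<le> k \<Longrightarrow> Y k \<omega> \<in> F" by (simp add: G_def)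
      show "\<And>k \<omega> \<omega>'. 1 \<le> k \<Longrightarrow> \<omega> \<in> G \<Longrightarrow> \<omega>' \<in> G \<Longrightarrow> \<forall>i\<in>{1..<k}. Y i \<omega> = Y i \<omega>' \<Longrightarrow>
        1 \<le> k \<and> inverse (real (Suc j)) < gap t n k \<omega> \<Longrightarrow> 1 \<le> k \<and> inverse (real (Suc j)) < gap t n k \<omega>'"
        using determined[OF t n] by metis
    qed
    with G show ?thesis
    proof eventually_elim
      case (elim \<omega>)
      show ?case
      proof
        assume "\<exists>\<^sub>F k in sequentially. inverse (real (Suc j)) < gap t n k \<omega>"
        then have "\<exists>\<^sub>F k in sequentially. 1 \<le> k \<and> inverse (real (Suc j)) < gap t n k \<omega>"
          using frequently_eventually_conj[OF _ eventually_ge_at_top[of 1]] by blast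
        then have "\<exists>\<^sub>F k in sequentially. (1 \<le> k \<and> inverse (real (Suc j)) < gap t n k \<omega>) \<and> Y k \<omega> \<in> B"
          using elim(2) by blast
        then show "\<exists>\<^sub>F k in sequentially. inverse (real (Suc j)) < gap t n k \<omega> \<and> passes_through (\<lambda>t. \<xi>s k t \<omega>) n"
          by (rule frequently_elim1) (use pass[OF elim(1)] in blast)
      qed
    qed
  qed
  have nodes_finite: "finite (nodes P r)" if "r \<le> T" for r
    using that
  proof (induction r)
    case 0
    have "nodes P 0 = {[]}" by (auto simp: nodes_def)
    then show ?case by simp
  next
    case (Suc r)
    have "nodes P (Suc r) \<subseteq> (\<lambda>(m, v). m @ [v]) ` (nodes P r \<times> supp P (Suc r))"
      by (auto simp: nodes_Suc image_iff)
    then show ?case using Suc supp_finite[of "Suc r"] by (elim finite_subset) auto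
  qed
  have "AE \<omega> in M. \<forall>t\<in>{2..T}. \<forall>n\<in>nodes P (t - 1). \<forall>j.
      (\<exists>\<^sub>F k in sequentially. inverse (real (Suc j)) < gap t n k \<omega>) \<longrightarrow>
      (\<exists>\<^sub>F k in sequentially. inverse (real (Suc j)) < gap t n k \<omega> \<and> passes_through (\<lambda>t. \<xi>s k t \<omega>) n)"
    (is "AE \<omega> in M. ?io \<omega>")
  proof (rule AE_finite_allI)
    fix t assume t: "t \<in> {2..T}"
    show "AE \<omega> in M. \<forall>n\<in>nodes P (t - 1). \<forall>j.
      (\<exists>\<^sub>F k in sequentially. inverse (real (Suc j)) < gap t n k \<omega>) \<longrightarrow>
      (\<exists>\<^sub>F k in sequentially. inverse (real (Suc j)) < gap t n k \<omega> \<and> passes_through (\<lambda>t. \<xi>s k t \<omega>) n)"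
    proof (rule AE_finite_allI)
      show "finite (nodes P (t - 1))" by (rule nodes_finite) (use t in auto)
    qed (use io[OF t] in \<open>simp add: AE_all_countable\<close>)
  qed simp
  with G have "AE \<omega> in M. \<omega> \<in> G \<and> ?io \<omega>" by eventually_elim blast
  then have all: "AE \<omega> in M.
      (\<lambda>k. stage_value P 1 (\<lambda>x. ereal (Q (k - 1) 2 \<omega> x)) (x_init P) (xi_first P)) \<longlonglongrightarrow> optimal_value P
      \<and> (\<forall>t\<in>{2..T}. \<exists>Qs :: real^'n \<Rightarrow> real.
              continuous_on (state_set P (t - 1)) Qs \<and>
              uniform_limit (state_set P (t - 1)) (\<lambda>k. Q k t \<omega>) Qs sequentially \<and>
              (\<forall>n\<in>nodes P (t - 1). \<forall>xbar.
                 accumulation_point (\<lambda>k. xn k n \<omega>) xbar \<longrightarrow>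
                 ereal (Qs xbar) = cost_to_go P t xbar))"
  proof eventually_elim
    case (elim \<omega>)
    interpret S: isddp_simulation P e \<delta> \<epsilon> Q0 "\<lambda>k t. \<xi>s k t \<omega>" "\<lambda>k t. xf k t \<omega>"
           "\<lambda>k t v. xb k t v \<omega>" "\<lambda>k t v. lam k t v \<omega>" "\<lambda>k t. Q k t \<omega>" "\<lambda>k n. xn k n \<omega>"
      using elim by (simp add: sims_def G_def)
    have "S.gap t n k = gap t n k \<omega>" for t n k by (simp add: S.gap_def gap_def)
    then have gap0: "S.gap t n \<longlonglongrightarrow> 0" if "t \<in> {2..Suc T}" "n \<in> nodes P (t - 1)" for t n
      using elim by (intro S.gap_tendsto_0[OF _ that]) simp
    have "[xi_first P] \<in> nodes P (2 - 1)" using supp_first by (simp add: nodes_def)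
    then have "(\<lambda>k. stage_value P 1 (\<lambda>x. ereal (Q (k - 1) 2 \<omega> x)) (x_init P) (xi_first P)) \<longlonglongrightarrow> optimal_value P"
      using horizon_pos by (intro S.first_stage_limit gap0) auto
    moreover have "\<exists>Qs :: real^'n \<Rightarrow> real.
              continuous_on (state_set P (t - 1)) Qs \<and>
              uniform_limit (state_set P (t - 1)) (\<lambda>k. Q k t \<omega>) Qs sequentially \<and>
              (\<forall>n\<in>nodes P (t - 1). \<forall>xbar.
                 accumulation_point (\<lambda>k. xn k n \<omega>) xbar \<longrightarrow>
                 ereal (Qs xbar) = cost_to_go P t xbar)" if t: "t \<in> {2..T}" for t
    proof -
      have t': "t \<in> {2..Suc T}" using t by auto
      show ?thesis
        using S.Qlim[OF t'] S.Qlim_at_accumulation_point[OF t _ gap0[OF t']] by blast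
    qed
    ultimately show ?case by blast
  qed
  show ?thesis
  proof (intro conjI ballI)
    show "AE \<omega> in M. (\<lambda>k. stage_value P 1 (\<lambda>x. ereal (Q (k - 1) 2 \<omega> x)) (x_init P) (xi_first P))
              \<longlonglongrightarrow> optimal_value P"
      using all by eventually_elim blast
    fix t assume t: "t \<in> {2..T}"
    show "AE \<omega> in M. \<exists>Qs :: real^'n \<Rightarrow> real.
              continuous_on (state_set P (t - 1)) Qs \<and>
              uniform_limit (state_set P (t - 1)) (\<lambda>k. Q k t \<omega>) Qs sequentially \<and>
              (\<forall>n\<in>nodes P (t - 1). \<forall>xbar.
                 accumulation_point (\<lambda>k. xn k n \<omega>) xbar \<longrightarrow>
                 ereal (Qs xbar) = cost_to_go P t xbar)"
      using all by eventually_elim (use t in blast)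
  qed
qed

end
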